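(* Let $\ell\ge0$ be an integer, $k>0$, $0<a<\infty$, and let $\varphi$ be a real-valued function on $(0,\infty)$ such that $$\int_a^\infty|\varphi'(r)|\,dr+\int_a^\infty|\varphi(r)|^2\,dr+\int_0^a|\varphi(r)|\,r\,dr<\infty .$$ Put $\theta=kr-\tfrac12\ell\pi$ and $$V_0(r,k)=\exp\Big(\frac{\mathrm{i}}{2k}\int_a^r\varphi(u)\,du\Big).$$ Then (for a suitable choice of the constant $N$) the solution $y_\ell$ of $$\Big(\frac{d^2}{dr^2}-\frac{\ell(\ell+1)}{r^2}+\varphi(r)+k^2\Big)y_\ell(r)=0$$ which satisfies $y_\ell(r)\sim N r^{\ell+1}$ as $r\to0$ has the form $$y_\ell(r)\sim \mathrm{e}^{-\mathrm{i}\theta}V_0(r,k)^{-1}-\mathrm{e}^{\mathrm{i}\theta}V_0(r,k)\,S_\ell(k),\qquad r\to\infty,$$ for some complex number $S_\ell(k)$ not depending on $r$.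
   Context: As $r\to\infty$, the relation $y(r)\sim F(r)$ means $y(r)-F(r)\to0$; as $r\to0$, $y(r)\sim Nr^{\ell+1}$ means $y(r)/r^{\ell+1}\to N$, where $N\neq0$ is a constant (a normalization of the solution). The function $\varphi$ is locally absolutely continuous on $[a,\infty)$ and $\varphi'$ is its derivative. The number $S_\ell(k)$ is called the stationary generalized scattering function and $V_0$ the stationary deviation factor. *)

theory Defs
  imports "HOL-Analysis.Analysis"
begin

text \<open>
  The \<open>\<epsilon>\<close>-\<open>\<delta>\<close> definition of absolute continuity on a set of reals. A division is a finite family
  of nonempty compact intervals with pairwise disjoint interiors; the division of its own union
  is just such a family, which need not cover \<open>S\<close>.
\<close>

definition absolutely_continuous_fun_on :: "real set \<Rightarrow> (real \<Rightarrow> 'a::real_normed_vector) \<Rightarrow> bool" where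
  "absolutely_continuous_fun_on S f \<longleftrightarrow>
     (\<forall>\<epsilon>>0. \<exists>\<delta>>0. \<forall>\<D>. \<D> division_of \<Union>\<D> \<and> \<Union>\<D> \<subseteq> S \<and> (\<Sum>K\<in>\<D>. Sup K - Inf K) < \<delta> \<longrightarrow>
        (\<Sum>K\<in>\<D>. norm (f (Sup K) - f (Inf K))) < \<epsilon>)"

definition locally_absolutely_continuous_fun_on :: "real set \<Rightarrow> (real \<Rightarrow> 'a::real_normed_vector) \<Rightarrow> bool" where
  "locally_absolutely_continuous_fun_on S f \<longleftrightarrow>
     (\<forall>c d. {c..d} \<subseteq> S \<longrightarrow> absolutely_continuous_fun_on {c..d} f)"

text \<open>
  Since the potential is only locally integrable near the origin, solutions are taken in the
  sense of Caratheodory: \<open>y\<close> is differentiable with locally absolutely continuous derivative on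
  \<open>(0,\<infinity>)\<close>, and the equation holds almost everywhere.
\<close>

definition radial_solution :: "nat \<Rightarrow> real \<Rightarrow> (real \<Rightarrow> real) \<Rightarrow> (real \<Rightarrow> complex) \<Rightarrow> bool" where
  "radial_solution l k \<phi> y \<longleftrightarrow>
     (\<exists>y'. (\<forall>r>0. (y has_vector_derivative y' r) (at r)) \<and>
           locally_absolutely_continuous_fun_on {0<..} y' \<and>
           (AE r in lebesgue. r > 0 \<longrightarrow>
              (\<exists>y''. (y' has_vector_derivative y'') (at r) \<and>
                 y'' - complex_of_real (real l * (real l + 1) / r\<^sup>2) * y r
                   + complex_of_real (\<phi> r) * y r + (complex_of_real k)\<^sup>2 * y r = 0)))"

definition regular_solution ::
    "nat \<Rightarrow> real \<Rightarrow> (real \<Rightarrow> real) \<Rightarrow> complex \<Rightarrow> (real \<Rightarrow> complex) \<Rightarrow> bool" where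
  "regular_solution l k \<phi> N y \<longleftrightarrow>
     radial_solution l k \<phi> y \<and>
     ((\<lambda>r. y r / complex_of_real (r ^ (l + 1))) \<longlongrightarrow> N) (at_right 0)"

text \<open>
  The Lebesgue measure (rather than the Borel one) is used because \<open>\<phi>\<close> is only Lebesgue measurable
  on \<open>(0,a)\<close>. The interval integral is oriented, so the formula also makes sense for \<open>r < a\<close>.
\<close>

definition deviation_factor :: "(real \<Rightarrow> real) \<Rightarrow> real \<Rightarrow> real \<Rightarrow> real \<Rightarrow> complex" where
  "deviation_factor \<phi> a r k =
     exp (\<i> / (2 * complex_of_real k) *
       complex_of_real (interval_lebesgue_integral lebesgue (ereal a) (ereal r) \<phi>))"

definition phase :: "nat \<Rightarrow> real \<Rightarrow> real \<Rightarrow> real" where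
  "phase l k r = k * r - real l * pi / 2"

end

theory Submission
  imports Defs
begin

text \<open>
  Writing \<open>y = r\<^sup>l\<^sup>+\<^sup>1 w\<close> turns the regular solution into the solution of a Volterra equation
  \<open>w = 1 + T w\<close> whose kernel is dominated by the integrable function \<open>t |\<phi> t + k\<^sup>2|\<close>; the Neumann
  series converges, and two solutions with the same normalization have quotients \<open>w\<close> that differ by
  a solution of the homogeneous equation, hence not at all. At infinity \<open>\<phi>\<close> tends to \<open>0\<close>, as it has
  integrable derivative and is square integrable. With the local wave number \<open>m = k + \<phi>/2k\<close> and
  \<open>p = exp (ikr) V\<^sub>0\<close>, so that \<open>p' = i m p\<close>, a real solution has amplitude \<open>\<alpha> = (y' + i m y) / p\<close>
  satisfying \<open>\<alpha>' = (l(l+1)/r\<^sup>2 + \<phi>\<^sup>2/4k\<^sup>2 + i \<phi>'/2k) y / p\<close>. The bracket is integrable and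
  \<open>|y|\<close> is at most a constant times \<open>|\<alpha>|\<close>, so \<open>\<alpha>\<close> tends to some \<open>A \<noteq> 0\<close>, and \<open>y = Im (\<alpha> p) / m\<close>
  gives the asymptotic form, with \<open>N\<close> chosen to normalize the coefficient of \<open>cnj p\<close>.
\<close>

section \<open>Absolutely continuous functions\<close>

text \<open>The wave number \<open>k + \<phi>/2k\<close> is the first-order expansion of the square
  root of \<open>k^2 + \<phi>\<close>. Its square exceeds \<open>k^2 + \<phi>\<close> by exactly
  \<open>\<phi>^2/4k^2\<close>, which is where square integrability enters; the integrability of
  \<open>\<phi>'\<close> pays for the variation of the wave number itself. Working with a real
  solution matters: \<open>y'\<close> and \<open>m y\<close> are then the real and imaginary parts
  of one number, so a single amplitude controls \<open>y\<close> and can vanish only if both Cauchy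
  data do. Uniqueness has to cover complex competitors, hence the vector-valued estimates near the
  origin. There \<open>k^2\<close> is treated as part of the potential, so that the free solutions
  are the pure powers \<open>r^(l+1)\<close> and \<open>r^(-l)\<close>. The obstacle behind the
  first part is that \<open>\<phi>'\<close> and \<open>y''\<close> exist only off a null set, which
  may be uncountable. Recovering a function from such a derivative rests on absolute continuity, and
  every product or phase factor formed later must be shown to inherit it.\<close>

lemma division_of_Union_intervalE:
  fixes \<D> :: "real set set"
  assumes "\<D> division_of \<Union>\<D>" "K \<in> \<D>" "\<Union>\<D> \<subseteq> {c..d}"
  obtains u v where "K = {u..v}" "u \<le> v" "Inf K = u" "Sup K = v" "u \<in> {c..d}" "v \<in> {c..d}"
proof -
  obtain u v where K: "K = {u..v}"
    using division_ofD(4)[OF assms(1,2)] by auto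
  moreover have "K \<noteq> {}"
    using division_ofD(3)[OF assms(1,2)] .
  ultimately have "u \<le> v" by simp
  moreover have "K \<subseteq> {c..d}" using assms by blast
  ultimately show ?thesis using that[of u v] K by auto
qed

text \<open>The common source of the rules for Lipschitz functions, sums, bilinear products, linear
  images and exponentials: each reduces to an increment estimate. Two dominating functions are
  allowed because the increment of a product involves those of both factors.\<close>

lemma absolutely_continuous_fun_on_dominated:
  fixes f :: "real \<Rightarrow> 'a::real_normed_vector" and g :: "real \<Rightarrow> 'b::real_normed_vector"
    and h :: "real \<Rightarrow> 'c::real_normed_vector"
  assumes g: "absolutely_continuous_fun_on {c..d} g" and h: "absolutely_continuous_fun_on {c..d} h"
    and le: "\<And>s t. \<lbrakk>c \<le> s; s \<le> t; t \<le> d\<rbrakk> \<Longrightarrow>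
      norm (f t - f s) \<le> B * (norm (g t - g s) + norm (h t - h s))"
  shows "absolutely_continuous_fun_on {c..d} f"
  unfolding absolutely_continuous_fun_on_def
proof (intro allI impI)
  fix e :: real assume e: "e > 0"
  \<comment> \<open>\<open>B\<close> may be zero or negative; this majorant is positive, so one can
    divide by it.\<close>
  define C where "C = \<bar>B\<bar> + 1"
  have C: "C > 0" by (simp add: C_def)
  have e': "e / (2 * C) > 0" using e C by simp
  obtain d1 where d1: "d1 > 0" and D1: "\<And>\<D>. \<lbrakk>\<D> division_of \<Union>\<D>; \<Union>\<D> \<subseteq> {c..d};
      (\<Sum>K\<in>\<D>. Sup K - Inf K) < d1\<rbrakk> \<Longrightarrow> (\<Sum>K\<in>\<D>. norm (g (Sup K) - g (Inf K))) < e / (2 * C)"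
    using g e' unfolding absolutely_continuous_fun_on_def by meson
  obtain d2 where d2: "d2 > 0" and D2: "\<And>\<D>. \<lbrakk>\<D> division_of \<Union>\<D>; \<Union>\<D> \<subseteq> {c..d};
      (\<Sum>K\<in>\<D>. Sup K - Inf K) < d2\<rbrakk> \<Longrightarrow> (\<Sum>K\<in>\<D>. norm (h (Sup K) - h (Inf K))) < e / (2 * C)"
    using h e' unfolding absolutely_continuous_fun_on_def by meson
  show "\<exists>\<delta>>0. \<forall>\<D>. \<D> division_of \<Union>\<D> \<and> \<Union>\<D> \<subseteq> {c..d} \<and> (\<Sum>K\<in>\<D>. Sup K - Inf K) < \<delta> \<longrightarrow>
      (\<Sum>K\<in>\<D>. norm (f (Sup K) - f (Inf K))) < e"
  proof (intro exI[of _ "min d1 d2"] conjI allI impI; (elim conjE)?)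
    show "0 < min d1 d2" using d1 d2 by simp
    fix \<D> :: "real set set"
    assume D: "\<D> division_of \<Union>\<D>" "\<Union>\<D> \<subseteq> {c..d}" "(\<Sum>K\<in>\<D>. Sup K - Inf K) < min d1 d2"
    have "(\<Sum>K\<in>\<D>. norm (f (Sup K) - f (Inf K))) \<le>
        (\<Sum>K\<in>\<D>. C * (norm (g (Sup K) - g (Inf K)) + norm (h (Sup K) - h (Inf K))))"
    proof (rule sum_mono)
      fix K assume "K \<in> \<D>"
      then obtain u v where uv: "u \<le> v" "Inf K = u" "Sup K = v" "u \<in> {c..d}" "v \<in> {c..d}"
        using division_of_Union_intervalE D by metis
      have "norm (f v - f u) \<le> B * (norm (g v - g u) + norm (h v - h u))"
        using le uv by auto
      also have "\<dots> \<le> C * (norm (g v - g u) + norm (h v - h u))"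
        by (rule mult_right_mono) (auto simp: C_def)
      finally show "norm (f (Sup K) - f (Inf K)) \<le>
          C * (norm (g (Sup K) - g (Inf K)) + norm (h (Sup K) - h (Inf K)))"
        using uv by simp
    qed
    also have "\<dots> = C * ((\<Sum>K\<in>\<D>. norm (g (Sup K) - g (Inf K))) + (\<Sum>K\<in>\<D>. norm (h (Sup K) - h (Inf K))))"
      by (simp add: sum_distrib_left sum.distrib distrib_left)
    also have "\<dots> < C * (e / (2 * C) + e / (2 * C))"
      using D1[of \<D>] D2[of \<D>] D C by (intro mult_strict_left_mono add_strict_mono) auto
    also have "\<dots> = e" using C by simp
    finally show "(\<Sum>K\<in>\<D>. norm (f (Sup K) - f (Inf K))) < e" .
  qed
qed

lemma absolutely_continuous_fun_on_ident: "absolutely_continuous_fun_on {c..d} (\<lambda>x::real. x)"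
  unfolding absolutely_continuous_fun_on_def
proof (intro allI impI)
  fix e :: real assume "e > 0"
  have "(\<Sum>K\<in>\<D>. norm (Sup K - Inf K)) = (\<Sum>K\<in>\<D>. Sup K - Inf K)"
    if "\<D> division_of \<Union>\<D>" "\<Union>\<D> \<subseteq> {c..d}" for \<D> :: "real set set"
  proof (rule sum.cong)
    fix K assume "K \<in> \<D>"
    then show "norm (Sup K - Inf K) = Sup K - Inf K"
      using division_of_Union_intervalE[OF that(1) _ that(2)]
      by (metis abs_of_nonneg diff_ge_0_iff_ge real_norm_def)
  qed auto
  then show "\<exists>\<delta>>0. \<forall>\<D>. \<D> division_of \<Union>\<D> \<and> \<Union>\<D> \<subseteq> {c..d} \<and> (\<Sum>K\<in>\<D>. Sup K - Inf K) < \<delta> \<longrightarrow>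
      (\<Sum>K\<in>\<D>. norm (Sup K - Inf K)) < e"
    using \<open>e > 0\<close> by (intro exI[of _ e]) auto
qed

lemma absolutely_continuous_fun_on_lipschitz:
  fixes f :: "real \<Rightarrow> 'a::real_normed_vector"
  assumes "\<And>s t. \<lbrakk>c \<le> s; s \<le> t; t \<le> d\<rbrakk> \<Longrightarrow> norm (f t - f s) \<le> B * (t - s)"
  shows "absolutely_continuous_fun_on {c..d} f"
  by (rule absolutely_continuous_fun_on_dominated[OF absolutely_continuous_fun_on_ident
        absolutely_continuous_fun_on_ident, of _ _ _ "B/2"]) (use assms in \<open>simp add: algebra_simps\<close>)

text \<open>A single interval \<open>{s..t}\<close> is already a division, so the condition on
  families contains uniform continuity.\<close>

lemma absolutely_continuous_fun_on_imp_continuous_on: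
  fixes f :: "real \<Rightarrow> 'a::real_normed_vector"
  assumes "absolutely_continuous_fun_on {c..d} f"
  shows "continuous_on {c..d} f"
  unfolding continuous_on_iff
proof (intro ballI allI impI)
  fix x e :: real assume x: "x \<in> {c..d}" and "e > 0"
  then obtain \<delta> where \<delta>: "\<delta> > 0" and D: "\<And>\<D>. \<lbrakk>\<D> division_of \<Union>\<D>; \<Union>\<D> \<subseteq> {c..d};
      (\<Sum>K\<in>\<D>. Sup K - Inf K) < \<delta>\<rbrakk> \<Longrightarrow> (\<Sum>K\<in>\<D>. norm (f (Sup K) - f (Inf K))) < e"
    using assms unfolding absolutely_continuous_fun_on_def by meson
  have *: "norm (f t - f s) < e" if "s \<le> t" "t - s < \<delta>" "s \<in> {c..d}" "t \<in> {c..d}" for s t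
  proof -
    have "{{s..t}} division_of {s..t}"
      using that division_of_self[of s t] by (simp add: box_real)
    then show ?thesis using D[of "{{s..t}}"] that by auto
  qed
  show "\<exists>\<delta>>0. \<forall>x'\<in>{c..d}. dist x' x < \<delta> \<longrightarrow> dist (f x') (f x) < e"
  proof (intro exI[of _ \<delta>] conjI ballI impI)
    fix x' assume "x' \<in> {c..d}" "dist x' x < \<delta>"
    then show "dist (f x') (f x) < e"
      using *[of x' x] *[of x x'] x by (cases "x \<le> x'") (auto simp: dist_norm norm_minus_commute)
  qed (rule \<delta>)
qed

lemma absolutely_continuous_fun_on_subinterval:
  assumes "absolutely_continuous_fun_on S f" "T \<subseteq> S"
  shows "absolutely_continuous_fun_on T f"
  using assms unfolding absolutely_continuous_fun_on_def by (meson order_trans)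

lemma absolutely_continuous_fun_on_cong:
  fixes f g :: "real \<Rightarrow> 'a::real_normed_vector"
  assumes "absolutely_continuous_fun_on {c..d} f" "\<And>x. x \<in> {c..d} \<Longrightarrow> f x = g x"
  shows "absolutely_continuous_fun_on {c..d} g"
  by (rule absolutely_continuous_fun_on_dominated[OF assms(1) assms(1), of _ "1/2"])
    (use assms(2) in auto)

lemma integral_division_le:
  fixes f :: "real \<Rightarrow> real"
  assumes f: "f integrable_on {c..d}" and nonneg: "\<And>x. x \<in> {c..d} \<Longrightarrow> 0 \<le> f x"
    and D: "\<D> division_of \<Union>\<D>" "\<Union>\<D> \<subseteq> {c..d}"
  shows "(\<Sum>K\<in>\<D>. integral K f) \<le> integral {c..d} f"
proof -
  have i: "f integrable_on \<Union>\<D>"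
    using D f integrable_on_subdivision by blast
  then have "integral (\<Union>\<D>) f = (\<Sum>K\<in>\<D>. integral K f)"
    using D(1) by (rule integral_combine_division_topdown)
  moreover have "integral (\<Union>\<D>) f \<le> integral {c..d} f"
    by (rule integral_subset_le[OF D(2) i f]) (use nonneg in auto)
  ultimately show ?thesis by simp
qed

text \<open>Truncate \<open>norm f\<close> at height \<open>n\<close>. By dominated convergence the
  part above the truncation has integral below \<open>e/2\<close> for some \<open>n\<close>, on any
  family of intervals; the truncated part contributes at most \<open>n\<close> times the total
  length.\<close>

lemma absolutely_continuous_fun_on_integral:
  fixes f :: "real \<Rightarrow> 'a::euclidean_space"
  assumes f: "f absolutely_integrable_on {c..d}"
  shows "absolutely_continuous_fun_on {c..d} (\<lambda>t. integral {c..t} f)"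
  unfolding absolutely_continuous_fun_on_def
proof (intro allI impI)
  fix e :: real assume e: "e > 0"
  define h where "h = (\<lambda>(n::nat) x. min (norm (f x)) (real n))"
  have nf: "(\<lambda>x. norm (f x)) absolutely_integrable_on {c..d}"
    using absolutely_integrable_norm[OF f] by (simp add: o_def)
  then have nfi: "(\<lambda>x. norm (f x)) integrable_on {c..d}"
    using set_lebesgue_integral_eq_integral(1) by blast
  have fi: "f integrable_on {c..d}" using f set_lebesgue_integral_eq_integral(1) by blast
  have hi: "h n integrable_on {c..d}" for n
  proof -
    have "h n absolutely_integrable_on {c..d}"
      unfolding h_def by (intro absolutely_integrable_min_1 nf absolutely_integrable_on_const) auto
    then show ?thesis using set_lebesgue_integral_eq_integral(1) by blast
  qed
  have "(\<lambda>n. integral {c..d} (h n)) \<longlonglongrightarrow> integral {c..d} (\<lambda>x. norm (f x))"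
  proof (rule dominated_convergence(2)[OF hi nfi])
    show "norm (h n x) \<le> norm (f x)" for n x by (auto simp: h_def)
    show "(\<lambda>n. h n x) \<longlonglongrightarrow> norm (f x)" for x
    proof (rule tendsto_eventually)
      obtain N where "norm (f x) \<le> real N" using real_arch_simple by blast
      then show "eventually (\<lambda>n. h n x = norm (f x)) sequentially"
        unfolding h_def eventually_sequentially by (metis min.absorb1 of_nat_mono order_trans)
    qed
  qed
  then have "eventually (\<lambda>n. dist (integral {c..d} (h n)) (integral {c..d} (\<lambda>x. norm (f x))) < e / 2) sequentially"
    using e by (intro tendstoD) auto
  then obtain n where n: "dist (integral {c..d} (h n)) (integral {c..d} (\<lambda>x. norm (f x))) < e / 2"
    by (auto simp: eventually_sequentially)
  have di: "(\<lambda>x. norm (f x) - h n x) integrable_on {c..d}"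
    using nfi hi by (rule integrable_diff)
  have small: "integral {c..d} (\<lambda>x. norm (f x) - h n x) < e / 2"
    using n integral_diff[OF nfi hi[of n]] unfolding dist_real_def by linarith
  \<comment> \<open>With total length below \<open>e / (2 * (n + 1))\<close> the truncated part
    stays within \<open>e/2\<close>; \<open>n + 1\<close> instead of \<open>n\<close> covers
    \<open>n = 0\<close>.\<close>
  show "\<exists>\<delta>>0. \<forall>\<D>. \<D> division_of \<Union>\<D> \<and> \<Union>\<D> \<subseteq> {c..d} \<and> (\<Sum>K\<in>\<D>. Sup K - Inf K) < \<delta> \<longrightarrow>
      (\<Sum>K\<in>\<D>. norm (integral {c..Sup K} f - integral {c..Inf K} f)) < e"
  proof (intro exI[of _ "e / (2 * (real n + 1))"] conjI allI impI; (elim conjE)?)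
    show "0 < e / (2 * (real n + 1))" using e by simp
    fix \<D> :: "real set set"
    assume D: "\<D> division_of \<Union>\<D>" "\<Union>\<D> \<subseteq> {c..d}" "(\<Sum>K\<in>\<D>. Sup K - Inf K) < e / (2 * (real n + 1))"
    have "(\<Sum>K\<in>\<D>. norm (integral {c..Sup K} f - integral {c..Inf K} f)) \<le>
        (\<Sum>K\<in>\<D>. integral K (\<lambda>x. norm (f x) - h n x) + real n * (Sup K - Inf K))"
    proof (rule sum_mono)
      fix K assume "K \<in> \<D>"
      then obtain u v where K: "K = {u..v}" and uv: "u \<le> v" "Inf K = u" "Sup K = v" "u \<in> {c..d}" "v \<in> {c..d}"
        using division_of_Union_intervalE[OF D(1) _ D(2)] by metis
      have sub: "{u..v} \<subseteq> {c..d}" using uv by auto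
      note int = integrable_on_subinterval[OF _ sub]
      have "integral {c..v} f = integral {c..u} f + integral {u..v} f"
        using uv by (intro Henstock_Kurzweil_Integration.integral_combine[symmetric]
            integrable_on_subinterval[OF fi]) auto
      then have "norm (integral {c..v} f - integral {c..u} f) = norm (integral {u..v} f)"
        by simp
      also have "\<dots> \<le> integral {u..v} (\<lambda>x. norm (f x))"
        using int[OF fi] int[OF nfi] by (rule integral_norm_bound_integral) simp
      also have "\<dots> = integral {u..v} (\<lambda>x. norm (f x) - h n x) + integral {u..v} (h n)"
        using integral_add[OF int[OF di] int[OF hi[of n]]] by simp
      also have "integral {u..v} (h n) \<le> integral {u..v} (\<lambda>x. real n)"
        using int[OF hi[of n]] by (intro integral_le) (auto simp: h_def)
      finally show "norm (integral {c..Sup K} f - integral {c..Inf K} f)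
          \<le> integral K (\<lambda>x. norm (f x) - h n x) + real n * (Sup K - Inf K)"
        using uv K by (simp add: mult.commute)
    qed
    also have "\<dots> = (\<Sum>K\<in>\<D>. integral K (\<lambda>x. norm (f x) - h n x)) + real n * (\<Sum>K\<in>\<D>. Sup K - Inf K)"
      by (simp add: sum.distrib sum_distrib_left)
    also have "(\<Sum>K\<in>\<D>. integral K (\<lambda>x. norm (f x) - h n x)) \<le> integral {c..d} (\<lambda>x. norm (f x) - h n x)"
      by (rule integral_division_le[OF di _ D(1,2)]) (auto simp: h_def)
    also have "real n * (\<Sum>K\<in>\<D>. Sup K - Inf K) \<le> real n * (e / (2 * (real n + 1)))"
      using D(3) by (intro mult_left_mono) auto
    also have "real n * (e / (2 * (real n + 1))) \<le> e / 2"
      using e by (simp add: field_simps)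
    finally show "(\<Sum>K\<in>\<D>. norm (integral {c..Sup K} f - integral {c..Inf K} f)) < e"
      using small by simp
  qed
qed

text \<open>The derivative is tied to the absolute continuity that makes it meaningful: the values
  of \<open>f'\<close> on a null set are arbitrary. Only interior points count, since nothing is
  known of \<open>f\<close> outside \<open>{c..d}\<close>; in this form the notion passes to
  subintervals.\<close>

definition has_ac_derivative :: "(real \<Rightarrow> 'a::euclidean_space) \<Rightarrow> (real \<Rightarrow> 'a) \<Rightarrow> real \<Rightarrow> real \<Rightarrow> bool" where
  "has_ac_derivative f f' c d \<longleftrightarrow> absolutely_continuous_fun_on {c..d} f \<and>
     (\<exists>N. negligible N \<and> (\<forall>x\<in>{c<..<d} - N. (f has_vector_derivative f' x) (at x)))"

lemma has_ac_derivativeI: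
  assumes "absolutely_continuous_fun_on {c..d} f" "negligible N"
    "\<And>x. x \<in> {c<..<d} - N \<Longrightarrow> (f has_vector_derivative f' x) (at x)"
  shows "has_ac_derivative f f' c d"
  using assms unfolding has_ac_derivative_def by blast

lemma has_ac_derivativeE:
  assumes "has_ac_derivative f f' c d"
  obtains N where "absolutely_continuous_fun_on {c..d} f" "negligible N"
    "\<And>x. x \<in> {c<..<d} - N \<Longrightarrow> (f has_vector_derivative f' x) (at x)"
  using assms unfolding has_ac_derivative_def by blast

text \<open>The fundamental theorem of calculus, proved on gauge sums, so that integrability of
  \<open>f'\<close> is part of the conclusion. Intervals tagged at good points are handled by
  differentiability. Those tagged in the exceptional set lie in an open set of small measure, and
  there absolute continuity bounds the sum of the increments of \<open>f\<close>.\<close>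

lemma has_ac_derivative_has_integral:
  fixes f :: "real \<Rightarrow> 'a::euclidean_space"
  assumes f: "has_ac_derivative f f' c d" and cd: "c \<le> d"
  shows "(f' has_integral (f d - f c)) {c..d}"
proof -
  from f obtain N where ac: "absolutely_continuous_fun_on {c..d} f"
    and N: "negligible N"
    and der: "\<And>x. x \<in> {c<..<d} - N \<Longrightarrow> (f has_vector_derivative f' x) (at x)"
    by (rule has_ac_derivativeE) blast
  \<comment> \<open>The end points join the exceptional set because the derivative is known only in
    the open interval.\<close>
  define M where "M = insert c (insert d N)"
  have M: "negligible M" using N by (simp add: M_def)
  have derM: "(f has_vector_derivative f' x) (at x)" if "x \<in> {c..d} - M" for x
    using that der by (auto simp: M_def)
  \<comment> \<open>With value zero on \<open>M\<close>, a bad tag leaves just the increment of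
    \<open>f\<close>, whatever \<open>f'\<close> is there.\<close>
  define f0 where "f0 = (\<lambda>x. if x \<in> M then 0 else f' x)"
  have "(f0 has_integral (f d - f c)) {c..d}"
    unfolding has_integral_real
  proof (intro allI impI)
    fix e :: real assume e: "e > 0"
    obtain \<delta> where \<delta>: "\<delta> > 0" and D: "\<And>\<D>. \<lbrakk>\<D> division_of \<Union>\<D>; \<Union>\<D> \<subseteq> {c..d};
        (\<Sum>K\<in>\<D>. Sup K - Inf K) < \<delta>\<rbrakk> \<Longrightarrow> (\<Sum>K\<in>\<D>. norm (f (Sup K) - f (Inf K))) < e / 2"
      using ac[unfolded absolutely_continuous_fun_on_def, rule_format, OF half_gt_zero[OF e]] by blast
    obtain T where T: "M \<subseteq> T" "open T" "measure lebesgue T < \<delta>" "T \<in> lmeasurable"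
    proof -
      obtain T where T: "open T" "M \<subseteq> T" "T - M \<in> lmeasurable" "emeasure lebesgue (T - M) < ennreal \<delta>"
        using sets_lebesgue_outer_open[OF negligible_imp_sets[OF M] \<delta>] by blast
      have null: "M \<in> null_sets lebesgue" using M by (simp add: negligible_iff_null_sets)
      have TM: "T = (T - M) \<union> M" using T by auto
      have "T \<in> lmeasurable"
        by (subst TM) (intro fmeasurable.Un T negligible_imp_measurable M)
      moreover have "measure lebesgue T = measure lebesgue (T - M)"
        using null T(1) by (intro measure_Diff_null_set[symmetric]) auto
      moreover have "measure lebesgue (T - M) < \<delta>"
        using T(3,4) \<delta> by (simp add: emeasure_eq_measure2 ennreal_less_iff)
      ultimately show ?thesis using that T by auto
    qed
    \<comment> \<open>The errors at good tags add up to \<open>E * (d - c)\<close>, at most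
      \<open>e/2\<close>; the summand 1 covers \<open>c = d\<close>.\<close>
    define E where "E = e / (2 * (d - c + 1))"
    have E: "E > 0" using e cd by (simp add: E_def)
    have "\<forall>x. \<exists>r>0. (x \<in> M \<longrightarrow> ball x r \<subseteq> T) \<and>
        (x \<in> {c..d} - M \<longrightarrow> (\<forall>y. norm (y - x) < r \<longrightarrow> norm (f y - f x - (y - x) *\<^sub>R f' x) \<le> E * norm (y - x)))"
    proof
      fix x
      show "\<exists>r>0. (x \<in> M \<longrightarrow> ball x r \<subseteq> T) \<and>
        (x \<in> {c..d} - M \<longrightarrow> (\<forall>y. norm (y - x) < r \<longrightarrow> norm (f y - f x - (y - x) *\<^sub>R f' x) \<le> E * norm (y - x)))"
      proof (cases "x \<in> M")
        case True
        then show ?thesis using T open_contains_ball by (metis DiffD2 subsetD)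
      next
        case False
        show ?thesis
        proof (cases "x \<in> {c..d}")
          case True
          then show ?thesis using derM[of x] False E
            unfolding has_vector_derivative_def has_derivative_at_alt by blast
        qed (use False in \<open>auto intro: exI[of _ 1]\<close>)
      qed
    qed
    then obtain r where r: "\<And>x. r x > 0" "\<And>x. x \<in> M \<Longrightarrow> ball x (r x) \<subseteq> T"
      "\<And>x y. \<lbrakk>x \<in> {c..d} - M; norm (y - x) < r x\<rbrakk> \<Longrightarrow> norm (f y - f x - (y - x) *\<^sub>R f' x) \<le> E * norm (y - x)"
      by metis
    show "\<exists>\<gamma>. gauge \<gamma> \<and> (\<forall>p. p tagged_division_of {c..d} \<and> \<gamma> fine p \<longrightarrow>
        norm ((\<Sum>(x,K)\<in>p. measure lborel K *\<^sub>R f0 x) - (f d - f c)) < e)"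
    proof (intro exI[of _ "\<lambda>x. ball x (r x)"] conjI allI impI; (elim conjE)?)
      show "gauge (\<lambda>x. ball x (r x))" using r(1) by (intro gauge_ball_dependent) auto
      fix p assume p: "p tagged_division_of {c..d}" and fine: "(\<lambda>x. ball x (r x)) fine p"
      have fin: "finite p" using p by blast
      have pK: "\<exists>u v. K = {u..v} \<and> u \<le> x \<and> x \<le> v \<and> c \<le> u \<and> v \<le> d \<and> K \<subseteq> ball x (r x)" if xK: "(x, K) \<in> p" for x K
      proof -
        obtain u v where uv: "K = {u..v}" using p xK by (metis tagged_division_ofD(4) box_real(2))
        have "x \<in> K" "K \<subseteq> {c..d}" using tagged_division_ofD(2,3)[OF p xK] by auto
        moreover have "K \<subseteq> ball x (r x)" using fine xK by (auto simp: fine_def)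
        ultimately show ?thesis using uv by auto
      qed
      define g where "g = (\<lambda>(x, K). measure lborel K *\<^sub>R f0 x - (f (Sup K) - f (Inf K)))"
      define p1 where "p1 = {xK \<in> p. fst xK \<in> M}"
      have p1: "p1 \<subseteq> p" by (auto simp: p1_def)
      then have fin1: "finite p1" using fin finite_subset by blast
      have "(\<Sum>(x,K)\<in>p. f (Sup K) - f (Inf K)) = f d - f c"
        using additive_tagged_division_1[OF cd p, of f] by simp
      then have "norm ((\<Sum>(x,K)\<in>p. measure lborel K *\<^sub>R f0 x) - (f d - f c)) = norm (\<Sum>xK\<in>p. g xK)"
        by (simp add: g_def sum_subtractf split_def)
      also have "\<dots> \<le> (\<Sum>xK\<in>p. norm (g xK))" by (rule norm_sum)
      also have "\<dots> = (\<Sum>xK\<in>p1. norm (g xK)) + (\<Sum>xK\<in>p - p1. norm (g xK))"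
        using sum.subset_diff[OF p1 fin, of "\<lambda>x. norm (g x)"] by simp
      also have "(\<Sum>xK\<in>p - p1. norm (g xK)) \<le> (\<Sum>(x,K)\<in>p - p1. E * (Sup K - Inf K))"
      proof (rule sum_mono, clarify)
        fix x K assume xK: "(x, K) \<in> p" "(x, K) \<notin> p1"
        obtain u v where uv: "K = {u..v}" "u \<le> x" "x \<le> v" "c \<le> u" "v \<le> d" "K \<subseteq> ball x (r x)"
          using pK[OF xK(1)] by auto
        have x: "x \<in> {c..d} - M" using xK uv by (auto simp: p1_def)
        have "u \<in> K" "v \<in> K" using uv by auto
        then have "u \<in> ball x (r x)" "v \<in> ball x (r x)" using uv(6) by blast+
        then have "norm (f u - f x - (u - x) *\<^sub>R f' x) \<le> E * norm (u - x)"
          "norm (f v - f x - (v - x) *\<^sub>R f' x) \<le> E * norm (v - x)"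
          using r(3)[OF x] by (auto simp: dist_real_def)
        then have "norm (f u - f x - (u - x) *\<^sub>R f' x) + norm (f v - f x - (v - x) *\<^sub>R f' x)
            \<le> E * (x - u) + E * (v - x)" using uv by simp
        \<comment> \<open>Straddle argument: the tag lies between \<open>u\<close> and
          \<open>v\<close>, so the two remainders at \<open>x\<close> are of sizes
          \<open>E (x - u)\<close> and \<open>E (v - x)\<close>, which sum to
          \<open>E (v - u)\<close>.\<close>
        moreover have "g (x, K) = (f u - f x - (u - x) *\<^sub>R f' x) - (f v - f x - (v - x) *\<^sub>R f' x)"
          using uv x by (simp add: g_def f0_def algebra_simps)
        then have "norm (g (x, K)) \<le> norm (f u - f x - (u - x) *\<^sub>R f' x) + norm (f v - f x - (v - x) *\<^sub>R f' x)"
          using norm_triangle_ineq4 by metis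
        ultimately show "norm (g (x, K)) \<le> E * (Sup K - Inf K)"
          using uv by (simp add: algebra_simps)
      qed
      also have "\<dots> \<le> (\<Sum>(x,K)\<in>p. E * (Sup K - Inf K))"
      proof (rule sum_mono2[OF fin Diff_subset])
        fix xK assume "xK \<in> p - (p - p1)"
        then obtain x K where xK: "xK = (x, K)" "(x, K) \<in> p" by (cases xK) auto
        then show "0 \<le> (case xK of (x, K) \<Rightarrow> E * (Sup K - Inf K))"
          using pK[OF xK(2)] E by auto
      qed
      also have "\<dots> = E * (d - c)"
        using additive_tagged_division_1[OF cd p, of "\<lambda>x. x"] by (simp add: sum_distrib_left[symmetric] split_def)
      also have "\<dots> \<le> e / 2"
        using e cd by (simp add: E_def field_simps)
      also have "(\<Sum>xK\<in>p1. norm (g xK)) < e / 2"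
      proof -
        have part: "p1 tagged_partial_division_of {c..d}"
          by (rule tagged_partial_division_subset[OF _ p1]) (use p in \<open>simp add: tagged_division_of_def\<close>)
        note td = tagged_partial_division_of_Union_self[OF part]
        let ?D = "snd ` p1"
        have div: "?D division_of \<Union>?D" using td by (rule division_of_tagged_division)
        have sub: "\<Union>?D \<subseteq> {c..d}" using p1 tagged_division_ofD(3)[OF p] by fastforce
        \<comment> \<open>Passing from tagged pairs to the set of intervals requires a summand that
          vanishes on degenerate intervals. This includes the empty one, where \<open>Sup\<close>
          and \<open>Inf\<close> say nothing.\<close>
        define \<Delta> where "\<Delta> = (\<lambda>K. if K = {} then 0 else norm (f (Sup K) - f (Inf K)))"
        have ne: "K \<noteq> {}" if "(x, K) \<in> p1" for x K
          using pK[of x K] that p1 by fastforce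
        have "(\<Sum>xK\<in>p1. norm (g xK)) = (\<Sum>(x,K)\<in>p1. \<Delta> K)"
          by (rule sum.cong) (use ne in \<open>auto simp: p1_def g_def f0_def \<Delta>_def norm_minus_commute\<close>)
        also have "\<dots> = (\<Sum>K\<in>?D. \<Delta> K)"
        proof (rule sum.over_tagged_division_lemma[OF td])
          fix u v :: real assume "box u v = {}"
          then have "{u..v} = {} \<or> u = v" by (auto simp: box_real)
          then show "\<Delta> (cbox u v) = 0" by (auto simp: box_real \<Delta>_def)
        qed
        also have "\<dots> = (\<Sum>K\<in>?D. norm (f (Sup K) - f (Inf K)))"
          by (rule sum.cong) (use ne in \<open>auto simp: \<Delta>_def\<close>)
        also have "\<dots> < e / 2"
        proof (rule D[OF div sub])
          have "(\<Sum>K\<in>?D. Sup K - Inf K) = (\<Sum>K\<in>?D. measure lebesgue K)"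
            by (rule sum.cong) (auto elim!: division_of_Union_intervalE[OF div _ sub])
          also have "\<dots> = measure lebesgue (\<Union>?D)"
            using content_division[OF div] by simp
          also have "\<dots> \<le> measure lebesgue T"
          proof (rule measure_mono_fmeasurable)
            show "\<Union>?D \<subseteq> T"
            proof (clarsimp)
              fix y x K assume "y \<in> K" "(x, K) \<in> p1"
              then show "y \<in> T" using pK[of x K] r(2)[of x] by (auto simp: p1_def)
            qed
            show "\<Union>?D \<in> sets lebesgue" using div
              by (metis fmeasurableD lmeasurable_division)
          qed (rule T(4))
          finally show "(\<Sum>K\<in>?D. Sup K - Inf K) < \<delta>" using T(3) by simp
        qed
        finally show ?thesis .
      qed
      finally show "norm ((\<Sum>(x,K)\<in>p. measure lborel K *\<^sub>R f0 x) - (f d - f c)) < e" by simp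
    qed
  qed
  then show ?thesis
    by (rule has_integral_spike[OF M, rotated]) (auto simp: f0_def)
qed

text \<open>Lebesgue differentiation. The available density statement concerns right-hand averages
  only; applied to the reflected function \<open>F (- x)\<close> it gives the left-hand ones, and
  the two exceptional sets are united after reflecting the second back.\<close>

lemma has_ac_derivative_integral:
  fixes f :: "real \<Rightarrow> 'a::euclidean_space"
  assumes f: "f absolutely_integrable_on {c..d}"
  shows "has_ac_derivative (\<lambda>t. integral {c..t} f) f c d"
proof -
  \<comment> \<open>Extension by zero makes all intervals admissible, including those that leave
    \<open>{c..d}\<close> and the reflected ones.\<close>
  define F where "F = (\<lambda>x. if x \<in> {c..d} then f x else 0)"
  have "f integrable_on {c..d}" using f set_lebesgue_integral_eq_integral(1) by blast
  then have FU: "F integrable_on UNIV" unfolding F_def by (subst integrable_restrict_UNIV)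
  then have Fi: "F integrable_on {u..v}" for u v
    using integrable_on_subinterval by fastforce
  have Fri: "(\<lambda>x. F (- x)) integrable_on {u..v}" for u v
    using Henstock_Kurzweil_Integration.integrable_reflect_real[of F "-u" "-v"] Fi[of "-v" "-u"] by simp
  obtain N where N: "negligible N" and NF: "\<And>x e. \<lbrakk>x \<notin> N; 0 < e\<rbrakk> \<Longrightarrow>
      \<exists>\<delta>>0. \<forall>h. 0 < h \<and> h < \<delta> \<longrightarrow> norm (integral {x..x + h} F /\<^sub>R h - F x) < e"
    using integrable_ccontinuous_explicit[of F] Fi by (auto simp: box_real)
  obtain N' where N': "negligible N'" and NF': "\<And>x e. \<lbrakk>x \<notin> N'; 0 < e\<rbrakk> \<Longrightarrow>
      \<exists>\<delta>>0. \<forall>h. 0 < h \<and> h < \<delta> \<longrightarrow> norm (integral {x..x + h} (\<lambda>x. F (- x)) /\<^sub>R h - F (- x)) < e"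
    using integrable_ccontinuous_explicit[of "\<lambda>x. F (- x)"] Fri by (auto simp: box_real)
  define M where "M = N \<union> uminus ` N'"
  have "negligible (uminus ` N')"
    by (rule negligible_differentiable_image_negligible[OF _ N'])
      (auto intro!: derivative_intros simp: differentiable_on_def)
  then have M: "negligible M" using N by (simp add: M_def)
  have "((\<lambda>t. integral {c..t} f) has_vector_derivative f x) (at x)" if x: "x \<in> {c<..<d} - M" for x
  proof -
    have "x \<notin> N" "- x \<notin> N'" using x by (auto simp: M_def image_iff)
    have Fx: "F x = f x" using x by (simp add: F_def)
    have incr: "integral {c..v} f - integral {c..u} f = integral {u..v} F"
      if "c \<le> u" "u \<le> v" "v \<le> d" for u v
    proof -
      have eq: "integral {c..t} f = integral {c..t} F" if "t \<le> d" for t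
        by (rule integral_cong) (use that in \<open>auto simp: F_def\<close>)
      have "integral {c..u} F + integral {u..v} F = integral {c..v} F"
        using that by (intro Henstock_Kurzweil_Integration.integral_combine Fi) auto
      then show ?thesis using that eq[of u] eq[of v] by (simp add: algebra_simps)
    qed
    show ?thesis
      unfolding has_vector_derivative_def has_derivative_at_alt
    proof (intro conjI allI impI)
      show "bounded_linear (\<lambda>h. h *\<^sub>R f x)" by (rule bounded_linear_scaleR_left)
      fix e :: real assume e: "e > 0"
      obtain d1 where d1: "d1 > 0" "\<And>h. \<lbrakk>0 < h; h < d1\<rbrakk> \<Longrightarrow> norm (integral {x..x + h} F /\<^sub>R h - F x) < e"
        using NF[OF \<open>x \<notin> N\<close> e] by blast
      obtain d2 where d2: "d2 > 0"
        "\<And>h. \<lbrakk>0 < h; h < d2\<rbrakk> \<Longrightarrow> norm (integral {-x..-x + h} (\<lambda>x. F (- x)) /\<^sub>R h - F (- (- x))) < e"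
        using NF'[OF \<open>- x \<notin> N'\<close> e] by blast
      define r where "r = Min {d1, d2, x - c, d - x}"
      have r: "r > 0" "r \<le> d1" "r \<le> d2" "r \<le> x - c" "r \<le> d - x"
        using x d1 d2 by (auto simp: r_def)
      have scale: "norm (I - h *\<^sub>R v) \<le> e * h" if "h > 0" "norm (I /\<^sub>R h - v) < e" for h I and v :: 'a
      proof -
        have "I - h *\<^sub>R v = h *\<^sub>R (I /\<^sub>R h - v)" using that by (simp add: algebra_simps)
        then have "norm (I - h *\<^sub>R v) = h * norm (I /\<^sub>R h - v)" using that by simp
        also have "\<dots> \<le> h * e" using that by (intro mult_left_mono) auto
        finally show ?thesis by (simp add: mult.commute)
      qed
      have "norm (integral {c..y} f - integral {c..x} f - (y - x) *\<^sub>R f x) \<le> e * norm (y - x)"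
        if y: "norm (y - x) < r" for y
      proof (cases x y rule: linorder_cases)
        case less
        have "norm (integral {x..x + (y - x)} F - (y - x) *\<^sub>R F x) \<le> e * (y - x)"
          by (rule scale) (use less y r d1(2)[of "y - x"] in auto)
        then show ?thesis using incr[of x y] less y r x Fx by simp
      next
        case greater
        have "norm (integral {-x..-x + (x - y)} (\<lambda>x. F (- x)) - (x - y) *\<^sub>R F x) \<le> e * (x - y)"
          by (rule scale) (use greater y r d2(2)[of "x - y"] in auto)
        moreover have "integral {-x..-x + (x - y)} (\<lambda>x. F (- x)) = integral {y..x} F"
          using Henstock_Kurzweil_Integration.integral_reflect_real[of x y F] by simp
        moreover have "integral {c..y} f - integral {c..x} f - (y - x) *\<^sub>R f x
            = - (integral {y..x} F - (x - y) *\<^sub>R F x)"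
          using incr[of y x] greater y r x Fx by (simp add: algebra_simps)
        ultimately show ?thesis using greater by (simp only: norm_minus_cancel real_norm_def) simp
      qed simp
      then show "\<exists>r>0. \<forall>y. norm (y - x) < r \<longrightarrow>
          norm (integral {c..y} f - integral {c..x} f - (y - x) *\<^sub>R f x) \<le> e * norm (y - x)"
        using r(1) by blast
    qed
  qed
  then show ?thesis
    by (rule has_ac_derivativeI[OF absolutely_continuous_fun_on_integral[OF f] M])
qed

section \<open>Differentiation rules for absolutely continuous functions\<close>

lemma has_ac_derivative_continuous_on:
  "has_ac_derivative f f' c d \<Longrightarrow> continuous_on {c..d} f"
  by (auto simp: has_ac_derivative_def intro: absolutely_continuous_fun_on_imp_continuous_on)

lemma has_ac_derivative_bounded:
  "has_ac_derivative f f' c d \<Longrightarrow> bounded (f ` {c..d})"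
  by (intro compact_imp_bounded compact_continuous_image has_ac_derivative_continuous_on compact_Icc)

lemma has_ac_derivative_C1:
  fixes f :: "real \<Rightarrow> 'a::euclidean_space"
  assumes der: "\<And>x. x \<in> {c..d} \<Longrightarrow> (f has_vector_derivative f' x) (at x within {c..d})"
    and cont: "continuous_on {c..d} f'"
  shows "has_ac_derivative f f' c d"
proof -
  have "bounded (f' ` {c..d})"
    by (intro compact_imp_bounded compact_continuous_image cont compact_Icc)
  then obtain B where B: "\<And>x. x \<in> {c..d} \<Longrightarrow> norm (f' x) \<le> B"
    by (metis bounded_iff image_eqI)
  have "absolutely_continuous_fun_on {c..d} f"
  proof (rule absolutely_continuous_fun_on_lipschitz)
    fix s t assume st: "c \<le> s" "s \<le> t" "t \<le> d"
    have "(f' has_integral (f t - f s)) {s..t}"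
      using st by (intro fundamental_theorem_of_calculus has_vector_derivative_within_subset[OF der]) auto
    moreover have "((\<lambda>x. B) has_integral (B * (t - s))) {s..t}"
      using has_integral_const_real[of B s t] st by (simp add: mult.commute)
    ultimately show "norm (f t - f s) \<le> B * (t - s)"
      using integral_norm_bound_integral[of f' "{s..t}" "\<lambda>x. B"] B st
      by (simp add: has_integral_iff mult.commute)
  qed
  moreover have "(f has_vector_derivative f' x) (at x)" if "x \<in> {c<..<d}" for x
    using der[of x] that by (auto simp: at_within_Icc_at)
  ultimately show ?thesis by (intro has_ac_derivativeI[of _ _ _ "{}"]) auto
qed

lemma has_ac_derivative_subinterval:
  assumes "has_ac_derivative f f' c d" "c \<le> c'" "d' \<le> d"
  shows "has_ac_derivative f f' c' d'"
proof -
  from assms(1) obtain N where ac: "absolutely_continuous_fun_on {c..d} f"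
    and N: "negligible N"
    and der: "\<And>x. x \<in> {c<..<d} - N \<Longrightarrow> (f has_vector_derivative f' x) (at x)"
    by (rule has_ac_derivativeE) blast
  show ?thesis
    by (rule has_ac_derivativeI[OF absolutely_continuous_fun_on_subinterval[OF ac] N])
      (use der assms in auto)
qed

lemma has_ac_derivative_cong:
  fixes f g :: "real \<Rightarrow> 'a::euclidean_space"
  assumes f: "has_ac_derivative f f' c d"
    and eq: "\<And>x. x \<in> {c..d} \<Longrightarrow> f x = g x" "\<And>x. x \<in> {c<..<d} \<Longrightarrow> f' x = g' x"
  shows "has_ac_derivative g g' c d"
proof -
  from f obtain N where ac: "absolutely_continuous_fun_on {c..d} f"
    and N: "negligible N"
    and der: "\<And>x. x \<in> {c<..<d} - N \<Longrightarrow> (f has_vector_derivative f' x) (at x)"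
    by (rule has_ac_derivativeE) blast
  have "(g has_vector_derivative g' x) (at x)" if x: "x \<in> {c<..<d} - N" for x
    using has_vector_derivative_transform_within_open[OF der[OF x], of "{c<..<d}" g] x eq by auto
  then show ?thesis
    using absolutely_continuous_fun_on_cong[OF ac eq(1)] N by (intro has_ac_derivativeI[of _ _ _ N])
qed

lemma has_ac_derivative_add:
  fixes f g :: "real \<Rightarrow> 'a::euclidean_space"
  assumes f: "has_ac_derivative f f' c d" and g: "has_ac_derivative g g' c d"
  shows "has_ac_derivative (\<lambda>x. f x + g x) (\<lambda>x. f' x + g' x) c d"
proof -
  from f obtain N where ac: "absolutely_continuous_fun_on {c..d} f"
    and N: "negligible N"
    and der: "\<And>x. x \<in> {c<..<d} - N \<Longrightarrow> (f has_vector_derivative f' x) (at x)"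
    by (rule has_ac_derivativeE) blast
  from g obtain N' where ac': "absolutely_continuous_fun_on {c..d} g"
    and N': "negligible N'"
    and der': "\<And>x. x \<in> {c<..<d} - N' \<Longrightarrow> (g has_vector_derivative g' x) (at x)"
    by (rule has_ac_derivativeE) blast
  have "norm (f t + g t - (f s + g s)) \<le> 1 * (norm (f t - f s) + norm (g t - g s))" for s t
    using norm_triangle_ineq[of "f t - f s" "g t - g s"] by (simp add: algebra_simps)
  then have "absolutely_continuous_fun_on {c..d} (\<lambda>x. f x + g x)"
    by (intro absolutely_continuous_fun_on_dominated[OF ac ac', of _ 1]) auto
  moreover have "((\<lambda>x. f x + g x) has_vector_derivative f' x + g' x) (at x)"
    if "x \<in> {c<..<d} - (N \<union> N')" for x
    using that by (intro has_vector_derivative_add der der') auto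
  ultimately show ?thesis
    using N N' by (intro has_ac_derivativeI[of _ _ _ "N \<union> N'"]) auto
qed

text \<open>Both factors are bounded on the compact interval, so the usual splitting
  \<open>P (f t - f s) (g t) + P (f s) (g t - g s)\<close> gives the increment estimate. Bilinearity
  covers real and complex products and scaling at once.\<close>

lemma has_ac_derivative_bilinear:
  fixes f :: "real \<Rightarrow> 'a::euclidean_space" and g :: "real \<Rightarrow> 'b::euclidean_space"
    and P :: "'a \<Rightarrow> 'b \<Rightarrow> 'c::euclidean_space"
  assumes P: "bounded_bilinear P"
    and f: "has_ac_derivative f f' c d" and g: "has_ac_derivative g g' c d"
  shows "has_ac_derivative (\<lambda>x. P (f x) (g x)) (\<lambda>x. P (f x) (g' x) + P (f' x) (g x)) c d"
proof -
  interpret bounded_bilinear P by (rule P)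
  from f obtain N where ac: "absolutely_continuous_fun_on {c..d} f"
    and N: "negligible N"
    and der: "\<And>x. x \<in> {c<..<d} - N \<Longrightarrow> (f has_vector_derivative f' x) (at x)"
    by (rule has_ac_derivativeE) blast
  from g obtain N' where ac': "absolutely_continuous_fun_on {c..d} g"
    and N': "negligible N'"
    and der': "\<And>x. x \<in> {c<..<d} - N' \<Longrightarrow> (g has_vector_derivative g' x) (at x)"
    by (rule has_ac_derivativeE) blast
  obtain K where K: "K > 0" "\<And>a b. norm (P a b) \<le> norm a * norm b * K" using pos_bounded by blast
  have "bounded (f ` {c..d})" "bounded (g ` {c..d})"
    using f g by (auto intro: has_ac_derivative_bounded)
  then obtain B C where B: "\<And>x. x \<in> {c..d} \<Longrightarrow> norm (f x) \<le> B"
    and C: "\<And>x. x \<in> {c..d} \<Longrightarrow> norm (g x) \<le> C"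
    by (metis bounded_iff image_eqI)
  have "absolutely_continuous_fun_on {c..d} (\<lambda>x. P (f x) (g x))"
  proof (rule absolutely_continuous_fun_on_dominated[OF ac ac'])
    fix s t assume st: "c \<le> s" "s \<le> t" "t \<le> d"
    have "0 \<le> norm (f s)" "norm (f s) \<le> B" using B st by auto
    then have pos: "0 \<le> max B C" by linarith
    have bc: "norm (g t) \<le> max B C" "norm (f s) \<le> max B C" using B C st by (auto simp: le_max_iff_disj)
    have "P (f t) (g t) - P (f s) (g s) = P (f t - f s) (g t) + P (f s) (g t - g s)"
      by (simp add: diff_left diff_right)
    then have "norm (P (f t) (g t) - P (f s) (g s)) \<le> norm (P (f t - f s) (g t)) + norm (P (f s) (g t - g s))"
      by (simp add: norm_triangle_ineq)
    also have "\<dots> \<le> norm (f t - f s) * max B C * K + max B C * norm (g t - g s) * K"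
      using K(1) bc pos by (intro add_mono order_trans[OF K(2)] mult_mono mult_nonneg_nonneg) auto
    finally show "norm (P (f t) (g t) - P (f s) (g s)) \<le>
        (max B C * K) * (norm (f t - f s) + norm (g t - g s))"
      by (simp add: algebra_simps)
  qed
  moreover have "((\<lambda>x. P (f x) (g x)) has_vector_derivative P (f x) (g' x) + P (f' x) (g x)) (at x)"
    if "x \<in> {c<..<d} - (N \<union> N')" for x
    using that by (intro has_vector_derivative der der') auto
  ultimately show ?thesis
    using N N' by (intro has_ac_derivativeI[of _ _ _ "N \<union> N'"]) auto
qed

lemmas has_ac_derivative_mult = has_ac_derivative_bilinear[OF bounded_bilinear_mult]
lemmas has_ac_derivative_scaleR = has_ac_derivative_bilinear[OF bounded_bilinear_scaleR]

lemma has_ac_derivative_linear: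
  fixes f :: "real \<Rightarrow> 'a::euclidean_space" and h :: "'a \<Rightarrow> 'b::euclidean_space"
  assumes h: "bounded_linear h" and f: "has_ac_derivative f f' c d"
  shows "has_ac_derivative (\<lambda>x. h (f x)) (\<lambda>x. h (f' x)) c d"
proof -
  interpret bounded_linear h by (rule h)
  from f obtain N where ac: "absolutely_continuous_fun_on {c..d} f"
    and N: "negligible N"
    and der: "\<And>x. x \<in> {c<..<d} - N \<Longrightarrow> (f has_vector_derivative f' x) (at x)"
    by (rule has_ac_derivativeE) blast
  obtain K where K: "\<And>a. norm (h a) \<le> norm a * K" using bounded by blast
  have "absolutely_continuous_fun_on {c..d} (\<lambda>x. h (f x))"
    by (rule absolutely_continuous_fun_on_dominated[OF ac ac, of _ "K/2"])
      (use K in \<open>simp add: diff[symmetric] mult.commute\<close>)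
  moreover have "((\<lambda>x. h (f x)) has_vector_derivative h (f' x)) (at x)"
    if "x \<in> {c<..<d} - N" for x
    using der[OF that] by (rule has_vector_derivative)
  ultimately show ?thesis
    using N by (intro has_ac_derivativeI[of _ _ _ N])
qed

lemma has_ac_derivative_exp:
  fixes f :: "real \<Rightarrow> real"
  assumes f: "has_ac_derivative f f' c d"
  shows "has_ac_derivative (\<lambda>x. exp (f x)) (\<lambda>x. exp (f x) * f' x) c d"
proof -
  from f obtain N where ac: "absolutely_continuous_fun_on {c..d} f"
    and N: "negligible N"
    and der: "\<And>x. x \<in> {c<..<d} - N \<Longrightarrow> (f has_vector_derivative f' x) (at x)"
    by (rule has_ac_derivativeE) blast
  have "bounded (f ` {c..d})"
    using f by (rule has_ac_derivative_bounded)
  then obtain B where B: "\<And>x. x \<in> {c..d} \<Longrightarrow> \<bar>f x\<bar> \<le> B"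
    by (metis bounded_iff image_eqI real_norm_def)
  have le: "exp y - exp x \<le> exp B * (y - x)" if "x \<le> y" "y \<le> B" for x y :: real
  proof -
    have "1 + (x - y) \<le> exp (x - y)" by (rule exp_ge_add_one_self)
    then have "exp y * (1 + (x - y)) \<le> exp y * exp (x - y)" by (intro mult_left_mono) auto
    then have "exp y - exp x \<le> exp y * (y - x)" by (simp add: exp_diff algebra_simps)
    also have "\<dots> \<le> exp B * (y - x)" using that by (intro mult_right_mono) auto
    finally show ?thesis .
  qed
  have abs_le: "\<bar>exp y - exp x\<bar> \<le> exp B * \<bar>y - x\<bar>" if "x \<le> B" "y \<le> B" for x y :: real
    using le[of x y] le[of y x] that by (cases "x \<le> y") (auto simp: abs_if)
  have "absolutely_continuous_fun_on {c..d} (\<lambda>x. exp (f x))"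
  proof (rule absolutely_continuous_fun_on_dominated[OF ac ac])
    fix s t assume st: "c \<le> s" "s \<le> t" "t \<le> d"
    then have "f s \<le> B" "f t \<le> B" using B[of s] B[of t] by auto
    then show "norm (exp (f t) - exp (f s)) \<le> (exp B / 2) * (norm (f t - f s) + norm (f t - f s))"
      using abs_le by simp
  qed
  moreover have "((\<lambda>x. exp (f x)) has_vector_derivative exp (f x) * f' x) (at x)"
    if "x \<in> {c<..<d} - N" for x
    using der[OF that] unfolding has_real_derivative_iff_has_vector_derivative[symmetric]
    by (rule DERIV_chain2[OF DERIV_exp])
  ultimately show ?thesis
    using N by (intro has_ac_derivativeI[of _ _ _ N])
qed

section \<open>Gronwall and Volterra\<close>

text \<open>Made for quotients by powers of \<open>r\<close>, which are continuous for
  \<open>r > 0\<close>: at the left end point boundedness takes the place of continuity, a single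
  point being negligible.\<close>

lemma absolutely_integrable_scaleR_continuous:
  fixes g :: "real \<Rightarrow> real" and h :: "real \<Rightarrow> 'a::euclidean_space"
  assumes g: "g absolutely_integrable_on {c..d}" and h: "continuous_on {c<..d} h"
    and bdd: "\<And>x. x \<in> {c<..d} \<Longrightarrow> norm (h x) \<le> B"
  shows "(\<lambda>x. g x *\<^sub>R h x) absolutely_integrable_on {c..d}"
proof -
  have 1: "g absolutely_integrable_on {c<..d}"
    by (rule absolutely_integrable_spike_set[OF g]) (auto intro: negligible_subset[of "{c}"])
  have 2: "h \<in> borel_measurable (lebesgue_on {c<..d})"
    by (rule continuous_imp_measurable_on_sets_lebesgue[OF h]) auto
  have 3: "bounded (h ` {c<..d})" using bdd unfolding bounded_iff by blast
  have 4: "bilinear (\<lambda>(a::'a) b. b *\<^sub>R a)"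
    unfolding bilinear_conv_bounded_bilinear
    by (rule bounded_bilinear.flip[OF bounded_bilinear_scaleR])
  have "(\<lambda>x. (\<lambda>(a::'a) b. b *\<^sub>R a) (h x) (g x)) absolutely_integrable_on {c<..d}"
    by (rule absolutely_integrable_bounded_measurable_product[OF 4 2 _ 3 1]) simp
  then have "(\<lambda>x. g x *\<^sub>R h x) absolutely_integrable_on {c<..d}" by simp
  then show ?thesis
    by (rule absolutely_integrable_spike_set) (auto intro: negligible_subset[of "{c}"])
qed

lemma absolutely_integrable_mult_continuous:
  fixes g h :: "real \<Rightarrow> real"
  assumes "g absolutely_integrable_on {c..d}" "continuous_on {c..d} h"
  shows "(\<lambda>x. g x * h x) absolutely_integrable_on {c..d}"
proof -
  have "bounded (h ` {c..d})"
    by (intro compact_imp_bounded compact_continuous_image assms compact_Icc)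
  then obtain B where "\<And>x. x \<in> {c..d} \<Longrightarrow> norm (h x) \<le> B" by (metis bounded_iff image_eqI)
  moreover have "continuous_on {c<..d} h" by (rule continuous_on_subset[OF assms(2)]) auto
  ultimately show ?thesis
    using absolutely_integrable_scaleR_continuous[OF assms(1), of h B] by auto
qed

text \<open>With \<open>G\<close> the primitive of \<open>g\<close>, the integrand is the derivative
  of \<open>exp (\<mu> G) / \<mu>\<close>. The choices \<open>\<mu> = 2\<close> and
  \<open>\<mu> = - 2\<close> produce the factor one half in the weighted estimates.\<close>

lemma has_integral_exp_integral:
  fixes g :: "real \<Rightarrow> real"
  assumes g: "g absolutely_integrable_on {c..d}" and "\<mu> \<noteq> 0" and st: "c \<le> s" "s \<le> t" "t \<le> d"
  shows "((\<lambda>x. g x * exp (\<mu> * integral {c..x} g)) has_integral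
    (exp (\<mu> * integral {c..t} g) - exp (\<mu> * integral {c..s} g)) / \<mu>) {s..t}"
proof -
  have "has_ac_derivative (\<lambda>x. \<mu> * integral {c..x} g) (\<lambda>x. \<mu> * g x) c d"
    by (rule has_ac_derivative_linear[OF bounded_linear_mult_right has_ac_derivative_integral[OF g]])
  from has_ac_derivative_exp[OF this]
  have "has_ac_derivative (\<lambda>x. exp (\<mu> * integral {c..x} g))
      (\<lambda>x. exp (\<mu> * integral {c..x} g) * (\<mu> * g x)) s t"
    by (rule has_ac_derivative_subinterval) (use st in auto)
  from has_ac_derivative_has_integral[OF this st(2)]
  have "((\<lambda>x. exp (\<mu> * integral {c..x} g) * (\<mu> * g x) / \<mu>) has_integral
      (exp (\<mu> * integral {c..t} g) - exp (\<mu> * integral {c..s} g)) / \<mu>) {s..t}"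
    by (rule has_integral_divide)
  then show ?thesis using \<open>\<mu> \<noteq> 0\<close> by (simp add: mult.commute)
qed

text \<open>The supremum of \<open>h / \<omega>\<close> is at most half of itself.\<close>

lemma weighted_gronwall:
  fixes g h \<omega> :: "real \<Rightarrow> real" and S :: "real \<Rightarrow> real set"
  assumes S: "\<And>x. x \<in> X \<Longrightarrow> S x \<subseteq> X" and g: "\<And>x. x \<in> X \<Longrightarrow> 0 \<le> g x"
    and \<omega>: "\<And>x. x \<in> X \<Longrightarrow> 0 < \<omega> x" and B: "\<And>x. x \<in> X \<Longrightarrow> h x \<le> B * \<omega> x"
    and gw: "\<And>x. x \<in> X \<Longrightarrow> (\<lambda>s. g s * \<omega> s) integrable_on S x"
      "\<And>x. x \<in> X \<Longrightarrow> integral (S x) (\<lambda>s. g s * \<omega> s) \<le> \<omega> x / 2"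
    and gh: "\<And>x. x \<in> X \<Longrightarrow> (\<lambda>s. g s * h s) integrable_on S x"
      "\<And>x. x \<in> X \<Longrightarrow> h x \<le> integral (S x) (\<lambda>s. g s * h s)"
    and x: "x \<in> X"
  shows "h x \<le> 0"
proof (rule ccontr)
  assume "\<not> h x \<le> 0"
  define M where "M = (SUP y\<in>X. h y / \<omega> y)"
  have bdd: "bdd_above ((\<lambda>y. h y / \<omega> y) ` X)"
    using B \<omega> by (intro bdd_aboveI2[of _ _ B]) (simp add: field_simps)
  have M: "h y \<le> M * \<omega> y" if "y \<in> X" for y
    using cSUP_upper[OF that bdd] \<omega>[OF that] by (simp add: M_def field_simps)
  have "0 < h x / \<omega> x" using \<open>\<not> h x \<le> 0\<close> \<omega>[OF x] by simp
  also have "\<dots> \<le> M" unfolding M_def by (rule cSUP_upper[OF x bdd])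
  finally have "M > 0" .
  have "h y / \<omega> y \<le> M / 2" if y: "y \<in> X" for y
  proof -
    have "h y \<le> integral (S y) (\<lambda>s. g s * h s)" by (rule gh(2)[OF y])
    also have "\<dots> \<le> integral (S y) (\<lambda>s. M * (g s * \<omega> s))"
    proof (rule integral_le[OF gh(1)[OF y]])
      show "(\<lambda>s. M * (g s * \<omega> s)) integrable_on S y"
        using gw(1)[OF y] by (rule integrable_on_mult_right)
      fix s assume "s \<in> S y"
      then have s: "s \<in> X" using S y by auto
      have "g s * h s \<le> g s * (M * \<omega> s)" using M[OF s] g[OF s] by (rule mult_left_mono)
      then show "g s * h s \<le> M * (g s * \<omega> s)" by (simp add: mult_ac)
    qed
    also have "\<dots> = M * integral (S y) (\<lambda>s. g s * \<omega> s)" by simp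
    also have "\<dots> \<le> M * (\<omega> y / 2)" using gw(2)[OF y] \<open>M > 0\<close> by (intro mult_left_mono) auto
    finally show ?thesis using \<omega>[OF y] by (simp add: field_simps)
  qed
  then have "M \<le> M / 2" unfolding M_def using x by (intro cSUP_least) auto
  then show False using \<open>M > 0\<close> by simp
qed

text \<open>For the weight \<open>exp (2 * integral {c..x} g)\<close>, integration against
  \<open>g\<close> reproduces at most half of it, however large the integral of \<open>g\<close> is,
  since the boundary term at \<open>c\<close> is subtracted. The weight is at least 1, so a bound on
  \<open>h\<close> is also a weighted one.\<close>

lemma gronwall_forward:
  fixes g h :: "real \<Rightarrow> real"
  assumes g: "g absolutely_integrable_on {c..d}" "\<And>x. x \<in> {c..d} \<Longrightarrow> 0 \<le> g x"
    and gh: "(\<lambda>s. g s * h s) integrable_on {c..d}" and B: "\<And>x. x \<in> {c..d} \<Longrightarrow> h x \<le> B"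
    and le: "\<And>x. x \<in> {c..d} \<Longrightarrow> h x \<le> integral {c..x} (\<lambda>s. g s * h s)"
    and x: "x \<in> {c..d}"
  shows "h x \<le> 0"
proof (rule weighted_gronwall[where h = h and x = x and X = "{c..d}" and S = "\<lambda>x. {c..x}"
      and \<omega> = "\<lambda>x. exp (2 * integral {c..x} g)" and B = "\<bar>B\<bar>" and g = g])
  fix x assume x: "x \<in> {c..d}"
  have int: "f integrable_on {c..d} \<Longrightarrow> f integrable_on {c..x}" for f :: "real \<Rightarrow> real"
    by (rule integrable_on_subinterval) (use x in auto)
  have "0 \<le> integral {c..x} g"
    using g x by (intro integral_nonneg int) (auto intro: set_lebesgue_integral_eq_integral(1))
  then have "\<bar>B\<bar> * 1 \<le> \<bar>B\<bar> * exp (2 * integral {c..x} g)" by (intro mult_left_mono) auto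
  then show "h x \<le> \<bar>B\<bar> * exp (2 * integral {c..x} g)" using B[OF x] by linarith
  have "((\<lambda>s. g s * exp (2 * integral {c..s} g)) has_integral
      (exp (2 * integral {c..x} g) - exp (2 * integral {c..c} g)) / 2) {c..x}"
    using has_integral_exp_integral[OF g(1), of 2 c x] x by simp
  then show "(\<lambda>s. g s * exp (2 * integral {c..s} g)) integrable_on {c..x}"
    "integral {c..x} (\<lambda>s. g s * exp (2 * integral {c..s} g)) \<le> exp (2 * integral {c..x} g) / 2"
    by (auto simp: has_integral_iff)
  show "(\<lambda>s. g s * h s) integrable_on {c..x}" using int[OF gh] .
qed (use assms in auto)

text \<open>Integration towards \<open>d\<close> calls for a decreasing weight. Its least value is
  \<open>exp (- 2 * integral {c..d} g)\<close>, which the enlarged bound for \<open>h\<close>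
  compensates.\<close>

lemma gronwall_backward:
  fixes g h :: "real \<Rightarrow> real"
  assumes g: "g absolutely_integrable_on {c..d}" "\<And>x. x \<in> {c..d} \<Longrightarrow> 0 \<le> g x"
    and gh: "(\<lambda>s. g s * h s) integrable_on {c..d}" and B: "\<And>x. x \<in> {c..d} \<Longrightarrow> h x \<le> B"
    and le: "\<And>x. x \<in> {c..d} \<Longrightarrow> h x \<le> integral {x..d} (\<lambda>s. g s * h s)"
    and x: "x \<in> {c..d}"
  shows "h x \<le> 0"
proof (rule weighted_gronwall[where h = h and x = x and X = "{c..d}" and S = "\<lambda>x. {x..d}"
      and \<omega> = "\<lambda>x. exp (- 2 * integral {c..x} g)"
      and B = "\<bar>B\<bar> * exp (2 * integral {c..d} g)" and g = g])
  fix x assume x: "x \<in> {c..d}"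
  have int: "f integrable_on {c..d} \<Longrightarrow> f integrable_on {x..d}" for f :: "real \<Rightarrow> real"
    by (rule integrable_on_subinterval) (use x in auto)
  have gi: "g integrable_on {c..d}" using g(1) set_lebesgue_integral_eq_integral(1) by blast
  have "0 \<le> integral {x..d} g" using g x by (intro integral_nonneg int gi) auto
  moreover have "integral {c..x} g + integral {x..d} g = integral {c..d} g"
    using x gi by (intro Henstock_Kurzweil_Integration.integral_combine) auto
  ultimately have "\<bar>B\<bar> * 1 \<le> \<bar>B\<bar> * exp (2 * integral {c..d} g - 2 * integral {c..x} g)"
    by (intro mult_left_mono) auto
  moreover have "exp (2 * integral {c..d} g - 2 * integral {c..x} g) =
      exp (2 * integral {c..d} g) * exp (- 2 * integral {c..x} g)"
    by (simp add: exp_add[symmetric])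
  ultimately show "h x \<le> \<bar>B\<bar> * exp (2 * integral {c..d} g) * exp (- 2 * integral {c..x} g)"
    using B[OF x] by (simp add: mult.assoc)
  have "((\<lambda>s. g s * exp (- 2 * integral {c..s} g)) has_integral
      (exp (- 2 * integral {c..d} g) - exp (- 2 * integral {c..x} g)) / (- 2)) {x..d}"
    using has_integral_exp_integral[OF g(1), of "- 2" x d] x by simp
  then show "(\<lambda>s. g s * exp (- 2 * integral {c..s} g)) integrable_on {x..d}"
    "integral {x..d} (\<lambda>s. g s * exp (- 2 * integral {c..s} g)) \<le> exp (- 2 * integral {c..x} g) / 2"
    by (auto simp: has_integral_iff divide_simps)
  show "(\<lambda>s. g s * h s) integrable_on {x..d}" using int[OF gh] .
qed (use assms in auto)

section \<open>The integral equation at the origin\<close>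

text \<open>
  With \<open>n = 2 l + 1\<close> and \<open>q t = t Q t\<close>, the function \<open>r ^ (l + 1) *\<^sub>R volterra n q f r\<close> is a particular
  solution of \<open>y'' - l (l + 1) / r\<^sup>2 y = Q r ^ (l + 1) f\<close>, obtained by variation of constants from the free
  solutions \<open>r ^ (l + 1)\<close> and \<open>1 / r ^ l\<close>. At \<open>r = 0\<close> division by zero gives the correct value \<open>0\<close>.
\<close>

definition volterra :: "nat \<Rightarrow> (real \<Rightarrow> real) \<Rightarrow> (real \<Rightarrow> 'a::euclidean_space) \<Rightarrow> real \<Rightarrow> 'a" where
  "volterra n q f r = (1 / real n) *\<^sub>R (integral {0..r} (\<lambda>t. q t *\<^sub>R f t) -
     (1 / r ^ n) *\<^sub>R integral {0..r} (\<lambda>t. (t ^ n * q t) *\<^sub>R f t))"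

text \<open>Since \<open>t ^ n \<le> r ^ n\<close> on \<open>{0..r}\<close>, the singular factor
  \<open>1 / r ^ n\<close> is harmless and each of the two integrals is at most that of
  \<open>\<bar>q\<bar> * norm f\<close>; this explains the factor 2.\<close>

lemma norm_volterra_le:
  fixes f :: "real \<Rightarrow> 'a::euclidean_space"
  assumes n: "n > 0" and q: "q absolutely_integrable_on {0..r}"
    and f: "continuous_on {0<..r} f" "\<And>x. x \<in> {0<..r} \<Longrightarrow> norm (f x) \<le> B" and r: "r \<ge> 0"
  shows "norm (volterra n q f r) \<le> integral {0..r} (\<lambda>t. 2 * \<bar>q t\<bar> * norm (f t))"
proof -
  define I where "I = integral {0..r} (\<lambda>t. \<bar>q t\<bar> * norm (f t))"
  have qf: "(\<lambda>t. q t *\<^sub>R f t) absolutely_integrable_on {0..r}"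
    by (rule absolutely_integrable_scaleR_continuous[OF q f])
  have nqf: "(\<lambda>t. \<bar>q t\<bar> * norm (f t)) integrable_on {0..r}"
    using qf unfolding absolutely_integrable_on_def by simp
  have 1: "norm (integral {0..r} (\<lambda>t. q t *\<^sub>R f t)) \<le> I"
    unfolding I_def using qf nqf
    by (intro integral_norm_bound_integral) (auto intro: set_lebesgue_integral_eq_integral(1))
  have tq: "(\<lambda>t. q t * t ^ n) absolutely_integrable_on {0..r}"
    by (intro absolutely_integrable_mult_continuous[OF q] continuous_intros)
  have tqf: "(\<lambda>t. (t ^ n * q t) *\<^sub>R f t) integrable_on {0..r}"
    using absolutely_integrable_scaleR_continuous[OF tq f]
    by (simp add: mult.commute set_lebesgue_integral_eq_integral(1))
  have "norm (integral {0..r} (\<lambda>t. (t ^ n * q t) *\<^sub>R f t)) \<le> integral {0..r} (\<lambda>t. r ^ n * (\<bar>q t\<bar> * norm (f t)))"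
  proof (rule integral_norm_bound_integral[OF tqf integrable_on_mult_right[OF nqf]])
    fix t assume t: "t \<in> {0..r}"
    then have "t ^ n * (\<bar>q t\<bar> * norm (f t)) \<le> r ^ n * (\<bar>q t\<bar> * norm (f t))"
      by (intro mult_right_mono power_mono) auto
    then show "norm ((t ^ n * q t) *\<^sub>R f t) \<le> r ^ n * (\<bar>q t\<bar> * norm (f t))"
      using t by (simp add: abs_mult mult_ac)
  qed
  then have "norm (integral {0..r} (\<lambda>t. (t ^ n * q t) *\<^sub>R f t)) \<le> r ^ n * I"
    by (simp add: I_def)
  moreover have "I \<ge> 0" unfolding I_def using nqf by (rule integral_nonneg) auto
  ultimately have 2: "norm ((1 / r ^ n) *\<^sub>R integral {0..r} (\<lambda>t. (t ^ n * q t) *\<^sub>R f t)) \<le> I"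
    using r n by (cases "r = 0") (auto simp: divide_simps mult.commute)
  have "norm (volterra n q f r) \<le> 1 / real n * (I + I)"
    unfolding volterra_def norm_scaleR using n
    by (intro mult_mono order_trans[OF norm_triangle_ineq4] add_mono 1 2) auto
  also have "\<dots> \<le> 1 * (I + I)" using n \<open>I \<ge> 0\<close> by (intro mult_right_mono) auto
  finally show ?thesis by (simp add: I_def mult.assoc)
qed

text \<open>Measured against the weight \<open>exp (2 * G r)\<close>, the operator halves every
  function on all intervals simultaneously. The terms of the Neumann series thus decay geometrically
  and the convergence is locally uniform on the whole half-line.\<close>

lemma volterra_fixed_point:
  fixes q :: "real \<Rightarrow> real"
  assumes n: "n > 0" and q: "\<And>R. q absolutely_integrable_on {0..R}"
  obtains w :: "real \<Rightarrow> real" where "continuous_on {0..} w" "\<And>r. r \<ge> 0 \<Longrightarrow> w r = 1 + volterra n q w r"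
proof -
  define g where "g = (\<lambda>t. 2 * \<bar>q t\<bar>)"
  define G where "G = (\<lambda>r. integral {0..r} g)"
  have g: "g absolutely_integrable_on {0..R}" for R
    unfolding g_def using q[of R] set_integrable_mult_right by (auto intro: set_integrable_abs)
  have gi: "g integrable_on {0..R}" for R using g set_lebesgue_integral_eq_integral(1) by blast
  have G0: "0 \<le> G r" for r
    unfolding G_def by (rule integral_nonneg[OF gi]) (auto simp: g_def)
  have Gmono: "G r \<le> G s" if "0 \<le> r" "r \<le> s" for r s
    unfolding G_def using that by (intro integral_subset_le gi) (auto simp: g_def)
  have bound: "\<exists>B. \<forall>x\<in>{0<..r}. norm (f x) \<le> B" if f: "continuous_on {0..} f" for r and f :: "real \<Rightarrow> real"
  proof -
    have "bounded (f ` {0..r})"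
      by (intro compact_imp_bounded compact_continuous_image continuous_on_subset[OF f]) auto
    then obtain B where "\<And>x. x \<in> {0..r} \<Longrightarrow> norm (f x) \<le> B" by (metis bounded_iff image_eqI)
    then show ?thesis by (intro exI[of _ B]) auto
  qed
  have T_le: "norm (volterra n q f r) \<le> integral {0..r} (\<lambda>t. g t * \<bar>f t\<bar>)"
    if f: "continuous_on {0..} f" and r: "r \<ge> 0" for r and f :: "real \<Rightarrow> real"
  proof -
    obtain B where "\<And>x. x \<in> {0<..r} \<Longrightarrow> norm (f x) \<le> B" using bound[OF f] by blast
    then show ?thesis
      using norm_volterra_le[OF n q, of r f B] r continuous_on_subset[OF f, of "{0<..r}"]
      by (force simp: g_def)
  qed
  have gf: "(\<lambda>t. g t * \<bar>f t\<bar>) integrable_on {0..r}"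
    if f: "continuous_on {0..} f" for r and f :: "real \<Rightarrow> real"
    by (intro set_lebesgue_integral_eq_integral(1) absolutely_integrable_mult_continuous g
        continuous_intros continuous_on_subset[OF f]) auto
  \<comment> \<open>At \<open>r = 0\<close> the factor \<open>1 / r ^ n\<close> forbids arguing
    termwise; the bound \<open>T_le\<close> by an integral over a shrinking interval is used
    instead.\<close>
  have T_cont: "continuous_on {0..} (volterra n q f)" if f: "continuous_on {0..} f" for f :: "real \<Rightarrow> real"
    unfolding continuous_on_eq_continuous_within
  proof
    fix r :: real assume "r \<in> {0..}"
    then consider "r = 0" | "r > 0" by fastforce
    then show "continuous (at r within {0..}) (volterra n q f)"
    proof cases
      case 1
      have "continuous_on {0..1} (\<lambda>r. integral {0..r} (\<lambda>t. g t * \<bar>f t\<bar>))"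
        by (rule indefinite_integral_continuous_1[OF gf[OF f]])
      then have "((\<lambda>r. integral {0..r} (\<lambda>t. g t * \<bar>f t\<bar>)) \<longlongrightarrow> integral {0..0} (\<lambda>t. g t * \<bar>f t\<bar>)) (at 0 within {0..1})"
        unfolding continuous_on_def by (rule bspec) auto
      then have lim: "((\<lambda>r. integral {0..r} (\<lambda>t. g t * \<bar>f t\<bar>)) \<longlongrightarrow> 0) (at 0 within {0..})"
        using at_within_Icc_at_right[of 0 "1::real"] by (simp add: at_within_Ici_at_right)
      have "((\<lambda>r. volterra n q f r) \<longlongrightarrow> 0) (at 0 within {0..})"
        by (rule Lim_null_comparison[OF _ lim]) (use T_le[OF f] in \<open>auto simp: eventually_at_filter\<close>)
      then show ?thesis using 1 by (simp add: continuous_within volterra_def[of _ _ _ 0])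
    next
      case 2
      have "continuous_on {0..r+1} (\<lambda>s. integral {0..s} (\<lambda>t. q t *\<^sub>R f t))"
        "continuous_on {0..r+1} (\<lambda>s. integral {0..s} (\<lambda>t. (t ^ n * q t) *\<^sub>R f t))"
      proof -
        have "(\<lambda>t. q t * f t) absolutely_integrable_on {0..r+1}"
          "(\<lambda>t. q t * (t ^ n * f t)) absolutely_integrable_on {0..r+1}"
          by (intro absolutely_integrable_mult_continuous q continuous_intros continuous_on_subset[OF f]; force)+
        then show "continuous_on {0..r+1} (\<lambda>s. integral {0..s} (\<lambda>t. q t *\<^sub>R f t))"
          "continuous_on {0..r+1} (\<lambda>s. integral {0..s} (\<lambda>t. (t ^ n * q t) *\<^sub>R f t))"
          by (intro indefinite_integral_continuous_1; simp add: set_lebesgue_integral_eq_integral(1) mult_ac)+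
      qed
      then have "continuous_on {0<..<r+1} (\<lambda>s. integral {0..s} (\<lambda>t. q t *\<^sub>R f t))"
        "continuous_on {0<..<r+1} (\<lambda>s. integral {0..s} (\<lambda>t. (t ^ n * q t) *\<^sub>R f t))"
        by (auto elim: continuous_on_subset)
      then have "continuous_on {0<..<r+1} (volterra n q f)"
        unfolding volterra_def by (intro continuous_intros) auto
      then have "isCont (volterra n q f) r" using 2 by (simp add: continuous_on_eq_continuous_at)
      then show ?thesis by (rule continuous_at_imp_continuous_at_within)
    qed
  qed
  define D where "D = (\<lambda>m. (volterra n q ^^ m) (\<lambda>_. 1 :: real))"
  have D0: "D 0 = (\<lambda>_. 1)" and DSuc: "D (Suc m) = volterra n q (D m)" for m by (auto simp: D_def)
  have Dc: "continuous_on {0..} (D m)" for m by (induction m) (simp_all add: D0 DSuc T_cont)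
  have DG: "\<bar>D m r\<bar> \<le> (1/2) ^ m * exp (2 * G r)" if "r \<ge> 0" for m r
    using that
  proof (induction m arbitrary: r)
    case 0
    then show ?case using G0 by (simp add: D0)
  next
    case (Suc m)
    have hi: "((\<lambda>t. g t * exp (2 * G t)) has_integral (exp (2 * G r) - exp (2 * G 0)) / 2) {0..r}"
      unfolding G_def using Suc.prems by (intro has_integral_exp_integral[OF g]) auto
    have "\<bar>D (Suc m) r\<bar> \<le> integral {0..r} (\<lambda>t. g t * \<bar>D m t\<bar>)"
      using T_le[OF Dc Suc.prems, of m] by (simp add: DSuc)
    also have "\<dots> \<le> integral {0..r} (\<lambda>t. (1/2) ^ m * (g t * exp (2 * G t)))"
    proof (rule integral_le[OF gf[OF Dc]])
      show "(\<lambda>t. (1/2) ^ m * (g t * exp (2 * G t))) integrable_on {0..r}"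
        using hi by (intro integrable_on_mult_right) auto
      fix t assume "t \<in> {0..r}"
      then have "g t * \<bar>D m t\<bar> \<le> g t * ((1/2) ^ m * exp (2 * G t))"
        by (intro mult_left_mono Suc.IH) (auto simp: g_def)
      then show "g t * \<bar>D m t\<bar> \<le> (1/2) ^ m * (g t * exp (2 * G t))" by (simp add: mult_ac)
    qed
    also have "\<dots> = (1/2) ^ m * ((exp (2 * G r) - exp (2 * G 0)) / 2)"
      using hi by (simp add: integral_unique)
    also have "\<dots> \<le> (1/2) ^ m * (exp (2 * G r) / 2)" by (intro mult_left_mono) auto
    finally show ?case by simp
  qed
  define w where "w = (\<lambda>r. \<Sum>m. D m r)"
  define s where "s = (\<lambda>N r. \<Sum>m<N. D m r)"
  have unif: "uniform_limit {0..R} s w sequentially" for R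
    unfolding s_def w_def
  proof (rule Weierstrass_m_test)
    show "summable (\<lambda>m. (1/2) ^ m * exp (2 * G R))"
      by (intro summable_mult2 summable_geometric) auto
    fix m r assume r: "r \<in> {0..R}"
    have "\<bar>D m r\<bar> \<le> (1/2) ^ m * exp (2 * G r)" using DG r by auto
    also have "\<dots> \<le> (1/2) ^ m * exp (2 * G R)" using Gmono r by (intro mult_left_mono) auto
    finally show "norm (D m r) \<le> (1/2) ^ m * exp (2 * G R)" by simp
  qed
  have sc: "continuous_on {0..} (s N)" for N unfolding s_def by (intro continuous_intros Dc)
  have wR: "continuous_on {0..R} w" for R
    by (rule uniform_limit_theorem[OF _ unif]) (auto intro!: always_eventually continuous_on_subset[OF sc])
  have wc: "continuous_on {0..} w"
    unfolding continuous_on_eq_continuous_within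
  proof
    fix r :: real assume r: "r \<in> {0..}"
    have "continuous (at r within {0..r+1}) w" using wR[of "r+1"] r by (simp add: continuous_on_eq_continuous_within)
    moreover have "at r within {0..} = at r within {0..r+1}"
      by (rule at_within_nhd[of _ "{..<r+1}"]) auto
    ultimately show "continuous (at r within {0..}) w" by simp
  qed
  have s_le: "\<bar>s N t\<bar> \<le> 2 * exp (2 * G r)" if "0 \<le> t" "t \<le> r" for N t r
  proof -
    have "\<bar>s N t\<bar> \<le> (\<Sum>m<N. \<bar>D m t\<bar>)" unfolding s_def by (rule sum_abs)
    also have "\<dots> \<le> (\<Sum>m<N. (1/2) ^ m * exp (2 * G r))"
      using DG that Gmono by (intro sum_mono order_trans[OF DG] mult_left_mono) auto
    also have "\<dots> = (\<Sum>m<N. (1/2) ^ m) * exp (2 * G r)" by (simp add: sum_distrib_right)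
    also have "\<dots> \<le> 2 * exp (2 * G r)" by (intro mult_right_mono) (auto simp: sum_gp_strict)
    finally show ?thesis .
  qed
  \<comment> \<open>Termwise integration, with a general density because it serves both
    \<open>q\<close> and \<open>t ^ n * q\<close>. The partial sums are dominated by
    \<open>2 * exp (2 * G r)\<close>, where 2 is the sum of the geometric series.\<close>
  have lim: "(\<lambda>m. integral {0..r} (\<lambda>t. p t * D m t)) sums integral {0..r} (\<lambda>t. p t * w t)"
    if p: "p absolutely_integrable_on {0..r}" for p r
  proof -
    have pD: "(\<lambda>t. p t * f t) integrable_on {0..r}" if "continuous_on {0..} f" for f :: "real \<Rightarrow> real"
      by (intro set_lebesgue_integral_eq_integral(1) absolutely_integrable_mult_continuous p
          continuous_on_subset[OF that]) auto
    have "(\<lambda>N. integral {0..r} (\<lambda>t. p t * s N t)) \<longlonglongrightarrow> integral {0..r} (\<lambda>t. p t * w t)"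
    proof (rule dominated_convergence(2)[OF pD[OF sc]])
      show "(\<lambda>t. 2 * exp (2 * G r) * \<bar>p t\<bar>) integrable_on {0..r}"
        using p by (intro integrable_on_mult_right) (auto simp: absolutely_integrable_on_def)
      fix N t assume t: "t \<in> {0..r}"
      have "\<bar>p t\<bar> * \<bar>s N t\<bar> \<le> \<bar>p t\<bar> * (2 * exp (2 * G r))" using s_le t by (intro mult_left_mono) auto
      then show "norm (p t * s N t) \<le> 2 * exp (2 * G r) * \<bar>p t\<bar>" by (simp add: abs_mult mult_ac)
    next
      fix t assume t: "t \<in> {0..r}"
      show "(\<lambda>N. p t * s N t) \<longlonglongrightarrow> p t * w t"
        by (intro tendsto_intros tendsto_uniform_limitI[OF unif t])
    qed
    moreover have "integral {0..r} (\<lambda>t. p t * s N t) = (\<Sum>m<N. integral {0..r} (\<lambda>t. p t * D m t))" for N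
      unfolding s_def sum_distrib_left by (intro integral_sum pD Dc) auto
    ultimately show ?thesis by (simp add: sums_def)
  qed
  have "w r = 1 + volterra n q w r" if r: "r \<ge> 0" for r
  proof -
    have "(\<lambda>t. q t * t ^ n) absolutely_integrable_on {0..r}"
      by (intro absolutely_integrable_mult_continuous q continuous_intros)
    then have tq: "(\<lambda>t. t ^ n * q t) absolutely_integrable_on {0..r}" by (simp add: mult.commute)
    have "(\<lambda>m. volterra n q (D m) r) sums volterra n q w r"
      unfolding volterra_def real_scaleR_def by (intro sums_mult sums_diff lim q tq)
    \<comment> \<open>Applying the operator shifts the series by one index; the missing term
      \<open>D 0 = 1\<close> is the inhomogeneity.\<close>
    then have "(\<lambda>m. D m r) sums (volterra n q w r + D 0 r)"
      by (subst sums_Suc_iff[symmetric]) (simp add: DSuc)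
    then show ?thesis by (simp add: w_def sums_iff D0)
  qed
  then show ?thesis using that wc by blast
qed

section \<open>The radial equation\<close>

text \<open>The derivative is named so that Cauchy data can be spoken of. The values lie in any
  Euclidean space, so that the real solution and its complex competitors share the lemmas. Intervals
  stay away from the origin, where \<open>q\<close> may be singular.\<close>

definition ode_solution :: "(real \<Rightarrow> real) \<Rightarrow> (real \<Rightarrow> 'a::euclidean_space) \<Rightarrow> (real \<Rightarrow> 'a) \<Rightarrow> bool" where
  "ode_solution q y y' \<longleftrightarrow> (\<forall>r>0. (y has_vector_derivative y' r) (at r)) \<and>
     (\<forall>c d. 0 < c \<longrightarrow> has_ac_derivative y' (\<lambda>r. q r *\<^sub>R y r) c d)"

lemma ode_solutionD:
  assumes "ode_solution q y y'"
  shows "r > 0 \<Longrightarrow> (y has_vector_derivative y' r) (at r)"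
    "0 < c \<Longrightarrow> has_ac_derivative y' (\<lambda>r. q r *\<^sub>R y r) c d"
  using assms by (simp_all add: ode_solution_def)

definition radial_coeff :: "nat \<Rightarrow> real \<Rightarrow> (real \<Rightarrow> real) \<Rightarrow> real \<Rightarrow> real" where
  "radial_coeff l k \<phi> r = real l * (real l + 1) / r\<^sup>2 - \<phi> r - k\<^sup>2"

lemma radial_equation_iff:
  "(y'' - complex_of_real (real l * (real l + 1) / r\<^sup>2) * y
     + complex_of_real (\<phi> r) * y + (complex_of_real k)\<^sup>2 * y = 0) \<longleftrightarrow> y'' = radial_coeff l k \<phi> r *\<^sub>R y"
  unfolding radial_coeff_def scaleR_conv_of_real
  by (simp add: algebra_simps)

text \<open>One null set for the half-line against one for each compact interval: the intervals from
  \<open>1 / (n + 1)\<close> to \<open>n + 1\<close> exhaust the half-line, and a countable union of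
  null sets is null.\<close>

lemma radial_solution_iff:
  "radial_solution l k \<phi> y \<longleftrightarrow> (\<exists>y'. ode_solution (radial_coeff l k \<phi>) y y')"
proof
  assume "radial_solution l k \<phi> y"
  then obtain y' where y': "\<And>r. r > 0 \<Longrightarrow> (y has_vector_derivative y' r) (at r)"
    and ac: "locally_absolutely_continuous_fun_on {0<..} y'"
    and AE: "AE r in lebesgue. r > 0 \<longrightarrow>
      (\<exists>y''. (y' has_vector_derivative y'') (at r) \<and> y'' = radial_coeff l k \<phi> r *\<^sub>R y r)"
    unfolding radial_solution_def radial_equation_iff by blast
  obtain N where "N \<in> null_sets lebesgue" and N': "{r. \<not> (r > 0 \<longrightarrow>
      (\<exists>y''. (y' has_vector_derivative y'') (at r) \<and> y'' = radial_coeff l k \<phi> r *\<^sub>R y r))} \<subseteq> N"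
    using AE unfolding eventually_ae_filter by auto
  then have N: "negligible N" by (simp add: negligible_iff_null_sets)
  have "has_ac_derivative y' (\<lambda>r. radial_coeff l k \<phi> r *\<^sub>R y r) c d" if "0 < c" for c d
  proof (rule has_ac_derivativeI[OF _ N])
    show "absolutely_continuous_fun_on {c..d} y'"
      using ac[unfolded locally_absolutely_continuous_fun_on_def, rule_format, of c d] that by force
    show "(y' has_vector_derivative radial_coeff l k \<phi> x *\<^sub>R y x) (at x)" if "x \<in> {c<..<d} - N" for x
    proof -
      have "0 < x" "x \<notin> N" using that \<open>0 < c\<close> by auto
      then show ?thesis using subsetD[OF N', of x] by auto
    qed
  qed
  then show "\<exists>y'. ode_solution (radial_coeff l k \<phi>) y y'"
    using y' unfolding ode_solution_def by auto
next
  assume "\<exists>y'. ode_solution (radial_coeff l k \<phi>) y y'"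
  then obtain y' where y': "\<And>r. r > 0 \<Longrightarrow> (y has_vector_derivative y' r) (at r)"
    and ac: "\<And>c d. 0 < c \<Longrightarrow> has_ac_derivative y' (\<lambda>r. radial_coeff l k \<phi> r *\<^sub>R y r) c d"
    by (auto simp: ode_solution_def)
  have "locally_absolutely_continuous_fun_on {0<..} y'"
    unfolding locally_absolutely_continuous_fun_on_def
  proof (intro allI impI)
    fix c d :: real assume cd: "{c..d} \<subseteq> {0<..}"
    show "absolutely_continuous_fun_on {c..d} y'"
    proof (cases "c \<le> d")
      case True
      then have "0 < c" using cd by auto
      from ac[OF this] show ?thesis by (rule has_ac_derivativeE)
    next
      case False
      \<comment> \<open>For an empty interval \<open>c\<close> need not be positive; another empty
        interval with positive left end takes its place.\<close>
      then have "{c..d} = {2..1}" by auto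
      moreover have "absolutely_continuous_fun_on {2..1} y'"
        using ac[of 2 1] by (auto elim: has_ac_derivativeE)
      ultimately show ?thesis by simp
    qed
  qed
  moreover have "AE r in lebesgue. r > 0 \<longrightarrow>
      (\<exists>y''. (y' has_vector_derivative y'') (at r) \<and> y'' = radial_coeff l k \<phi> r *\<^sub>R y r)"
  proof -
    have "\<exists>N. negligible N \<and> (\<forall>x\<in>{1 / (real n + 1)<..<real n + 1} - N.
        (y' has_vector_derivative radial_coeff l k \<phi> x *\<^sub>R y x) (at x))" for n
      using ac[of "1 / (real n + 1)" "real n + 1"] by (auto elim!: has_ac_derivativeE)
    then obtain N where N: "\<And>n. negligible (N n)" and der: "\<And>n x. x \<in> {1 / (real n + 1)<..<real n + 1} - N n \<Longrightarrow>
        (y' has_vector_derivative radial_coeff l k \<phi> x *\<^sub>R y x) (at x)"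
      by metis
    have "negligible (\<Union>n. N n)" using N by (rule negligible_Union_nat)
    then have "(\<Union>n. N n) \<in> null_sets lebesgue" by (simp add: negligible_iff_null_sets)
    moreover have "(y' has_vector_derivative radial_coeff l k \<phi> x *\<^sub>R y x) (at x)"
      if x: "x > 0" "x \<notin> (\<Union>n. N n)" for x
    proof -
      obtain n where n: "max x (1 / x) < real n" using reals_Archimedean2 by blast
      then have "1 / x < real n + 1" by simp
      then have "1 / (real n + 1) < x" using x by (simp add: field_simps)
      then show ?thesis using der[of x n] x n by auto
    qed
    ultimately show ?thesis
      unfolding eventually_ae_filter by (intro bexI[of _ "\<Union>n. N n"]) auto
  qed
  ultimately show "radial_solution l k \<phi> y"
    unfolding radial_solution_def radial_equation_iff using y' by blast
qed

lemma has_ac_derivative_powr: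
  assumes "0 < c"
  shows "has_ac_derivative (\<lambda>r. r powr s) (\<lambda>r. s * r powr (s - 1)) c d"
proof (rule has_ac_derivative_C1)
  show "((\<lambda>r. r powr s) has_vector_derivative s * x powr (s - 1)) (at x within {c..d})"
    if "x \<in> {c..d}" for x
    using that assms unfolding has_real_derivative_iff_has_vector_derivative[symmetric]
    by (intro has_field_derivative_at_within[OF has_real_derivative_powr]) auto
  show "continuous_on {c..d} (\<lambda>r. s * r powr (s - 1))"
    using assms by (intro continuous_intros) auto
qed

lemma ode_solution_continuous_on:
  "ode_solution q y y' \<Longrightarrow> continuous_on {0<..} y"
  by (intro continuous_at_imp_continuous_on ballI)
    (auto intro: has_vector_derivative_continuous ode_solutionD(1))

lemma ode_solution_has_ac_derivative:
  assumes y: "ode_solution q y y'" and c: "0 < c"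
  shows "has_ac_derivative y y' c d"
proof (rule has_ac_derivative_C1)
  show "(y has_vector_derivative y' x) (at x within {c..d})" if "x \<in> {c..d}" for x
    by (rule has_vector_derivative_at_within[OF ode_solutionD(1)[OF y]]) (use c that in auto)
  show "continuous_on {c..d} y'"
    by (rule has_ac_derivative_continuous_on[OF ode_solutionD(2)[OF y c]])
qed

text \<open>The Wronskian with the free solution \<open>r powr s\<close>, where \<open>s = l + 1\<close> or \<open>s = -l\<close>.\<close>

lemma has_ac_derivative_wronskian:
  fixes y :: "real \<Rightarrow> 'a::euclidean_space"
  assumes y: "ode_solution (\<lambda>r. L / r\<^sup>2 + Q r) y y'" and s: "s * (s - 1) = L" and c: "0 < c"
  shows "has_ac_derivative (\<lambda>r. r powr s *\<^sub>R y' r - (s * r powr (s - 1)) *\<^sub>R y r)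
    (\<lambda>r. (r powr s * Q r) *\<^sub>R y r) c d"
proof -
  have y': "has_ac_derivative y' (\<lambda>r. (L / r\<^sup>2 + Q r) *\<^sub>R y r) c d"
    by (rule ode_solutionD(2)[OF y c])
  have "has_ac_derivative (\<lambda>r. (- s) *\<^sub>R r powr (s - 1)) (\<lambda>r. (- s) *\<^sub>R ((s - 1) * r powr (s - 1 - 1))) c d"
    by (rule has_ac_derivative_linear[OF bounded_linear_scaleR_right has_ac_derivative_powr[OF c]])
  from has_ac_derivative_add[OF has_ac_derivative_scaleR[OF has_ac_derivative_powr[OF c, of s] y']
      has_ac_derivative_scaleR[OF this ode_solution_has_ac_derivative[OF y c]]]
  show ?thesis
  proof (rule has_ac_derivative_cong)
    fix r assume "r \<in> {c<..<d}"
    then have r: "r > 0" using c by auto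
    have "r powr (s - 1 - 1) = r powr s / r\<^sup>2" "r powr (s - 1) = r powr s / r"
      using r by (simp_all add: powr_diff power2_eq_square)
    then have coeff: "r powr s * (L / r\<^sup>2 + Q r) + (- s) * ((s - 1) * r powr (s - 1 - 1)) = r powr s * Q r"
      unfolding s[symmetric] using r by (simp add: field_simps power2_eq_square)
    show "r powr s *\<^sub>R (L / r\<^sup>2 + Q r) *\<^sub>R y r + (s * r powr (s - 1)) *\<^sub>R y' r +
         (((- s) *\<^sub>R r powr (s - 1)) *\<^sub>R y' r + ((- s) *\<^sub>R ((s - 1) * r powr (s - 1 - 1))) *\<^sub>R y r) =
         (r powr s * Q r) *\<^sub>R y r"
      unfolding coeff[symmetric] by (simp add: scaleR_add_left scaleR_diff_left scaleR_add_right distrib_left)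
  qed simp
qed

lemma powr_of_nat_add_1: "r > 0 \<Longrightarrow> r powr (real l + 1) = r ^ (l + 1)" for r :: real
  using powr_realpow[of r "l + 1"] by (simp add: add.commute)

lemma powr_minus_of_nat: "r > 0 \<Longrightarrow> r powr (- real l) = 1 / r ^ l" for r :: real
  using powr_realpow[of r l] by (simp add: powr_minus divide_inverse)

section \<open>The regular solution: uniqueness and existence\<close>

context
  fixes l :: nat and Q :: "real \<Rightarrow> real"
  assumes Q: "\<And>R. (\<lambda>t. t * Q t) absolutely_integrable_on {0..R}"
begin

text \<open>The Wronskians with \<open>r^(-l)\<close> and \<open>r^(l+1)\<close> are integrals plus
  constants \<open>c1\<close> and \<open>c2\<close>. Eliminating \<open>u'\<close> between them
  yields the Volterra equation for \<open>v = u / r^(l+1)\<close> with the extra term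
  \<open>(c1 - c2 / r^n) / n\<close>, which carries the free solutions contained in
  \<open>u\<close>. The limit at the origin forces both constants to vanish, and Gronwall's
  inequality finishes.\<close>

lemma regular_ode_solution_unique:
  fixes u :: "real \<Rightarrow> 'a::euclidean_space"
  assumes u: "ode_solution (\<lambda>r. real l * (real l + 1) / r\<^sup>2 + Q r) u u'"
    and lim: "((\<lambda>r. (1 / r ^ (l + 1)) *\<^sub>R u r) \<longlongrightarrow> 0) (at_right 0)" and r: "r > 0"
  shows "u r = 0"
proof -
  define q where "q = (\<lambda>t. t * Q t)"
  define n where "n = 2 * l + 1"
  have n: "n > 0" by (simp add: n_def)
  define v where "v = (\<lambda>r. (1 / r ^ (l + 1)) *\<^sub>R u r)"
  have uv: "u r = r ^ (l + 1) *\<^sub>R v r" if "r > 0" for r using that by (simp add: v_def)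
  have q: "q absolutely_integrable_on {0..R}" for R using Q by (simp add: q_def)
  \<comment> \<open>Division by zero happens to give the limit value, so \<open>v\<close> is
    continuous up to the origin.\<close>
  have v0: "v 0 = 0" by (simp add: v_def)
  have vc: "continuous_on {0..R} v" for R
    unfolding continuous_on_eq_continuous_within
  proof
    fix r assume "r \<in> {0..R}"
    then consider "r = 0" | "r > 0" by fastforce
    then show "continuous (at r within {0..R}) v"
    proof cases
      case 1
      have "(v \<longlongrightarrow> 0) (at 0 within {0..})" using lim by (simp add: v_def at_within_Ici_at_right)
      then show ?thesis using 1 v0 by (auto simp: continuous_within intro: tendsto_within_subset)
    next
      case 2
      have "continuous_on {0<..} v"
        unfolding v_def by (intro continuous_intros ode_solution_continuous_on[OF u]) auto
      then have "isCont v r" using 2 by (simp add: continuous_on_eq_continuous_at)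
      then show ?thesis by (rule continuous_at_imp_continuous_at_within)
    qed
  qed
  have "bounded (v ` {0..R})" for R
    by (intro compact_imp_bounded compact_continuous_image vc compact_Icc)
  then have "\<exists>B. \<forall>x\<in>{0..R}. norm (v x) \<le> B" for R by (simp add: bounded_iff)
  then obtain B where B: "\<And>x R. x \<in> {0..R} \<Longrightarrow> norm (v x) \<le> B R" by metis
  have vc': "continuous_on {0<..R} v" for R by (rule continuous_on_subset[OF vc[of R]]) auto
  have qv: "(\<lambda>t. q t *\<^sub>R v t) absolutely_integrable_on {0..R}" for R
    by (rule absolutely_integrable_scaleR_continuous[OF q vc' B[of _ R]]) auto
  have tq: "(\<lambda>t. t ^ n * q t) absolutely_integrable_on {0..R}" for R
  proof -
    have "(\<lambda>t. q t * t ^ n) absolutely_integrable_on {0..R}"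
      by (intro absolutely_integrable_mult_continuous q continuous_intros)
    then show ?thesis by (simp add: mult.commute)
  qed
  have tqv: "(\<lambda>t. (t ^ n * q t) *\<^sub>R v t) absolutely_integrable_on {0..R}" for R
    by (rule absolutely_integrable_scaleR_continuous[OF tq vc' B[of _ R]]) auto
  define J1 where "J1 = (\<lambda>r. integral {0..r} (\<lambda>t. q t *\<^sub>R v t))"
  define J2 where "J2 = (\<lambda>r. integral {0..r} (\<lambda>t. (t ^ n * q t) *\<^sub>R v t))"
  define W where "W = (\<lambda>s r. r powr s *\<^sub>R u' r - (s * r powr (s - 1)) *\<^sub>R u r)"
  have const: "W s r - integral {0..r} p = W s 1 - integral {0..1} p"
    if s: "s * (s - 1) = real l * (real l + 1)"
      and p: "\<And>t. t > 0 \<Longrightarrow> (t powr s * Q t) *\<^sub>R u t = p t" "\<And>R. p absolutely_integrable_on {0..R}"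
      and r: "r > 0" for s r and p :: "real \<Rightarrow> 'a"
  proof -
    have *: "W s y - W s x = integral {0..y} p - integral {0..x} p" if xy: "0 < x" "x \<le> y" for x y
    proof -
      have "has_ac_derivative (W s) (\<lambda>r. (r powr s * Q r) *\<^sub>R u r) x y"
        unfolding W_def by (rule has_ac_derivative_wronskian[OF u s xy(1)])
      then have "((\<lambda>r. (r powr s * Q r) *\<^sub>R u r) has_integral (W s y - W s x)) {x..y}"
        using xy(2) by (rule has_ac_derivative_has_integral)
      then have "(p has_integral (W s y - W s x)) {x..y}"
        by (rule has_integral_eq[rotated]) (use p(1) xy in auto)
      then have "W s y - W s x = integral {x..y} p" by (simp add: integral_unique)
      also have "integral {0..x} p + integral {x..y} p = integral {0..y} p"
        using xy p(2) by (intro Henstock_Kurzweil_Integration.integral_combine set_lebesgue_integral_eq_integral(1)) auto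
      then have "integral {x..y} p = integral {0..y} p - integral {0..x} p" by (simp add: algebra_simps)
      finally show ?thesis .
    qed
    show ?thesis using *[of 1 r] *[of r 1] r by (cases "r \<le> 1") (auto simp: algebra_simps)
  qed
  define c1 where "c1 = W (- real l) 1 - J1 1"
  define c2 where "c2 = W (real l + 1) 1 - J2 1"
  have c1: "W (- real l) r = c1 + J1 r" if r: "r > 0" for r
  proof -
    have "(t powr (- real l) * Q t) *\<^sub>R u t = q t *\<^sub>R v t" if "t > 0" for t
      using that by (simp add: powr_minus_of_nat uv q_def)
    from const[OF _ this qv r] show ?thesis
      unfolding c1_def J1_def by (simp add: algebra_simps)
  qed
  have c2: "W (real l + 1) r = c2 + J2 r" if r: "r > 0" for r
  proof -
    have "(t powr (real l + 1) * Q t) *\<^sub>R u t = (t ^ n * q t) *\<^sub>R v t" if "t > 0" for t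
      using that by (simp add: powr_of_nat_add_1 uv q_def n_def power_add mult_2_right mult_2 mult_ac)
    from const[OF _ this tqv r] show ?thesis
      unfolding c2_def J2_def by (simp add: algebra_simps)
  qed
  have nv: "v r = volterra n q v r + (1 / real n) *\<^sub>R (c1 - (1 / r ^ n) *\<^sub>R c2)" if r: "r > 0" for r
  proof -
    have 1: "W (- real l) r = (1 / r ^ l) *\<^sub>R u' r + (real l / r ^ (l + 1)) *\<^sub>R u r"
    proof -
      have e: "- real l - 1 = - real (l + 1)" by simp
      show ?thesis unfolding W_def e powr_minus_of_nat[OF r] by simp
    qed
    have 2: "W (real l + 1) r = r ^ (l + 1) *\<^sub>R u' r - ((real l + 1) * r ^ l) *\<^sub>R u r"
      using r powr_of_nat_add_1[OF r, of l] by (simp add: W_def powr_realpow)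
    have "W (- real l) r - (1 / r ^ n) *\<^sub>R W (real l + 1) r = ((2 * real l + 1) / r ^ (l + 1)) *\<^sub>R u r"
    proof -
      have "W (- real l) r - (1 / r ^ n) *\<^sub>R W (real l + 1) r =
          (1 / r ^ l - 1 / r ^ n * r ^ (l + 1)) *\<^sub>R u' r +
          (real l / r ^ (l + 1) + 1 / r ^ n * ((real l + 1) * r ^ l)) *\<^sub>R u r"
        unfolding 1 2 by (simp only: scaleR_add_left scaleR_diff_left scaleR_diff_right scaleR_scaleR) simp
      also have rn: "r ^ n = r ^ l * r ^ (l + 1)"
        by (simp only: n_def mult_2 power_add[symmetric] add.assoc)
      also have "1 / r ^ l - 1 / (r ^ l * r ^ (l + 1)) * r ^ (l + 1) = 0"
        using r by simp
      also have "1 / (r ^ l * r ^ (l + 1)) * ((real l + 1) * r ^ l) = (real l + 1) / r ^ (l + 1)"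
        using r by simp
      also have "real l / r ^ (l + 1) + (real l + 1) / r ^ (l + 1) = (2 * real l + 1) / r ^ (l + 1)"
        by (simp only: add_divide_distrib[symmetric]) simp
      finally show ?thesis unfolding rn by simp
    qed
    then have "v r = (1 / real n) *\<^sub>R (W (- real l) r - (1 / r ^ n) *\<^sub>R W (real l + 1) r)"
    proof -
      have "real n = 2 * real l + 1" by (simp add: n_def)
      then show ?thesis
        unfolding \<open>W (- real l) r - _ = _\<close> v_def by (simp flip: \<open>real n = _\<close>) (use n in simp)
    qed
    also have "\<dots> = volterra n q v r + (1 / real n) *\<^sub>R (c1 - (1 / r ^ n) *\<^sub>R c2)"
      unfolding c1[OF r] c2[OF r] volterra_def J1_def J2_def
      by (simp add: algebra_simps)
    finally show ?thesis .
  qed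
  have V_le: "norm (volterra n q v r) \<le> integral {0..r} (\<lambda>t. 2 * \<bar>q t\<bar> * norm (v t))" if "r \<ge> 0" for r
    by (rule norm_volterra_le[OF n q vc' B[of _ r]]) (use that in auto)
  have gi: "(\<lambda>t. 2 * \<bar>q t\<bar> * norm (v t)) integrable_on {0..R}" for R
    using qv[of R] unfolding absolutely_integrable_on_def
    by (auto simp: mult.assoc intro: integrable_on_mult_right)
  have Vlim: "(volterra n q v \<longlongrightarrow> 0) (at_right 0)"
  proof (rule Lim_null_comparison)
    have "continuous_on {0..1} (\<lambda>r. integral {0..r} (\<lambda>t. 2 * \<bar>q t\<bar> * norm (v t)))"
      by (rule indefinite_integral_continuous_1[OF gi])
    then have "((\<lambda>r. integral {0..r} (\<lambda>t. 2 * \<bar>q t\<bar> * norm (v t))) \<longlongrightarrow>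
        integral {0..0} (\<lambda>t. 2 * \<bar>q t\<bar> * norm (v t))) (at 0 within {0..1})"
      unfolding continuous_on_def by (rule bspec) auto
    then show "((\<lambda>r. integral {0..r} (\<lambda>t. 2 * \<bar>q t\<bar> * norm (v t))) \<longlongrightarrow> 0) (at_right 0)"
      using at_within_Icc_at_right[of 0 "1::real"] by simp
    show "\<forall>\<^sub>F r in at_right 0. norm (volterra n q v r) \<le> integral {0..r} (\<lambda>t. 2 * \<bar>q t\<bar> * norm (v t))"
      using V_le by (auto simp: eventually_at_filter)
  qed
  have vlim: "(v \<longlongrightarrow> 0) (at_right 0)" using lim by (simp add: v_def)
  have "((\<lambda>r. real n *\<^sub>R (v r - volterra n q v r)) \<longlongrightarrow> real n *\<^sub>R (0 - 0)) (at_right 0)"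
    by (intro tendsto_intros vlim Vlim)
  then have nlim: "((\<lambda>r. real n *\<^sub>R (v r - volterra n q v r)) \<longlongrightarrow> 0) (at_right 0)" by simp
  have "real n *\<^sub>R (v r - volterra n q v r) = c1 - (1 / r ^ n) *\<^sub>R c2" if "r > 0" for r
    by (subst nv[OF that]) (use n in simp)
  then have climit: "((\<lambda>r. c1 - (1 / r ^ n) *\<^sub>R c2) \<longlongrightarrow> 0) (at_right 0)"
    by (intro Lim_transform_eventually[OF nlim]) (auto simp: eventually_at_filter)
  \<comment> \<open>For \<open>r > 0\<close> the left side is the constant \<open>c2\<close>. The
    singular part is removed before the regular one: only with \<open>c2 = 0\<close> does the limit
    speak about \<open>c1\<close>.\<close>
  have "((\<lambda>r. r ^ n *\<^sub>R (c1 - (c1 - (1 / r ^ n) *\<^sub>R c2))) \<longlongrightarrow> 0 ^ n *\<^sub>R (c1 - 0)) (at_right 0)"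
    by (intro tendsto_intros climit)
  moreover have "(0::real) ^ n *\<^sub>R (c1 - 0) = 0" using n by simp
  ultimately have "((\<lambda>r. r ^ n *\<^sub>R (c1 - (c1 - (1 / r ^ n) *\<^sub>R c2))) \<longlongrightarrow> 0) (at_right 0)"
    by (simp only:)
  then have "((\<lambda>r::real. c2) \<longlongrightarrow> 0) (at_right 0)"
    by (rule Lim_transform_eventually) (use n in \<open>auto simp: eventually_at_filter\<close>)
  then have c2: "c2 = 0" by (simp add: tendsto_const_iff)
  then have c1: "c1 = 0" using climit by (simp add: tendsto_const_iff)
  have veq: "v r = volterra n q v r" if "r > 0" for r using nv[OF that] c1 c2 by simp
  have "norm (v r) \<le> 0"
  proof (rule gronwall_forward[where c = 0 and d = r and g = "\<lambda>t. 2 * \<bar>q t\<bar>" and B = "B r"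
        and h = "\<lambda>r. norm (v r)" and x = r])
    show "(\<lambda>t. 2 * \<bar>q t\<bar>) absolutely_integrable_on {0..r}"
      using q by (intro set_integrable_mult_right set_integrable_abs)
    show "(\<lambda>s. 2 * \<bar>q s\<bar> * norm (v s)) integrable_on {0..r}" by (rule gi)
    fix x assume x: "x \<in> {0..r}"
    show "norm (v x) \<le> B r" using B x by auto
    show "norm (v x) \<le> integral {0..x} (\<lambda>s. 2 * \<bar>q s\<bar> * norm (v s))"
      using V_le[of x] veq[of x] x v0 by (cases "x = 0") auto
  qed (use r in auto)
  then show "u r = 0" using uv[OF r] by simp
qed

text \<open>The fixed point \<open>w\<close> is merely continuous, so \<open>r^(l+1) * w\<close>
  cannot be differentiated directly. Replacing \<open>w\<close> by the right-hand side of its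
  equation expresses it through powers and the primitives \<open>J1\<close> and \<open>J2\<close>,
  which have derivatives almost everywhere.\<close>

lemma regular_ode_solution_exists:
  obtains y y' :: "real \<Rightarrow> real"
  where "ode_solution (\<lambda>r. real l * (real l + 1) / r\<^sup>2 + Q r) y y'"
    "((\<lambda>r. y r / r ^ (l + 1)) \<longlongrightarrow> 1) (at_right 0)"
proof -
  define q where "q = (\<lambda>t. t * Q t)"
  define n where "n = 2 * l + 1"
  have n: "n > 0" by (simp add: n_def)
  have q: "q absolutely_integrable_on {0..R}" for R using Q by (simp add: q_def)
  obtain w :: "real \<Rightarrow> real" where wc: "continuous_on {0..} w" and w: "\<And>r. r \<ge> 0 \<Longrightarrow> w r = 1 + volterra n q w r"
    using volterra_fixed_point[OF n q] by blast
  define J1 where "J1 = (\<lambda>r. integral {0..r} (\<lambda>t. q t * w t))"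
  define J2 where "J2 = (\<lambda>r. integral {0..r} (\<lambda>t. q t * (t ^ n * w t)))"
  have acJ: "has_ac_derivative J1 (\<lambda>t. q t * w t) c d" "has_ac_derivative J2 (\<lambda>t. q t * (t ^ n * w t)) c d"
    if "0 < c" for c d
  proof -
    have 1: "(\<lambda>t. q t * w t) absolutely_integrable_on {0..d}"
      "(\<lambda>t. q t * (t ^ n * w t)) absolutely_integrable_on {0..d}"
      by (intro absolutely_integrable_mult_continuous q continuous_intros continuous_on_subset[OF wc]; force)+
    show "has_ac_derivative J1 (\<lambda>t. q t * w t) c d" "has_ac_derivative J2 (\<lambda>t. q t * (t ^ n * w t)) c d"
      unfolding J1_def J2_def using that
      by (simp_all add: has_ac_derivative_subinterval[OF has_ac_derivative_integral[OF 1(1)]]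
          has_ac_derivative_subinterval[OF has_ac_derivative_integral[OF 1(2)]])
  qed
  define s where "s = real l + 1"
  define y where "y = (\<lambda>r. (r powr s * (real n + J1 r) - r powr (1 - s) * J2 r) / real n)"
  \<comment> \<open>As in variation of constants, the terms with the derivatives of
    \<open>J1\<close> and \<open>J2\<close> cancel, since
    \<open>r powr (1 - s) * r ^ n = r powr s\<close>. What remains is again absolutely
    continuous.\<close>
  define y' where "y' = (\<lambda>r. (s * r powr (s - 1) * (real n + J1 r) - (1 - s) * r powr (- s) * J2 r) / real n)"
  have yw: "y r = r ^ (l + 1) * w r" if r: "r > 0" for r
  proof -
    have J2: "integral {0..r} (\<lambda>t. (t ^ n * q t) *\<^sub>R w t) = J2 r" by (simp add: J2_def mult_ac)
    have J1: "integral {0..r} (\<lambda>t. q t *\<^sub>R w t) = J1 r" by (simp add: J1_def)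
    have "r powr (1 - s) = r powr s / r ^ n"
      using r powr_realpow[OF r, of n] powr_diff[of r s "real n"] by (simp add: s_def n_def)
    then have "y r = r powr s * ((real n + J1 r - J2 r / r ^ n) / real n)"
      by (simp add: y_def algebra_simps)
    also have "(real n + J1 r - J2 r / r ^ n) / real n = w r"
      using w[of r] r n unfolding volterra_def J1 J2 by (simp add: field_simps)
    finally show ?thesis using r powr_of_nat_add_1[OF r, of l] by (simp add: s_def)
  qed
  have acy: "has_ac_derivative y y' c d"
    and acy': "has_ac_derivative y' (\<lambda>r. (real l * (real l + 1) / r\<^sup>2 + Q r) * y r) c d"
    if c: "0 < c" for c d
  proof -
    have 1: "has_ac_derivative (\<lambda>r. real n + J1 r) (\<lambda>t. q t * w t) c d"
      using has_ac_derivative_add[OF has_ac_derivative_C1[of c d "\<lambda>_. real n" "\<lambda>_. 0"] acJ(1)[OF c, of d]] by simp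
    note mul = has_ac_derivative_mult
    note lin = has_ac_derivative_linear[OF bounded_linear_mult_right]
    note pw = has_ac_derivative_powr[OF c]
    have rs: "r powr (s - 1) = r powr s / r" "r powr (s - 2) = r powr s / r\<^sup>2"
      "r powr (1 - s) = r powr s / r ^ n" "r powr (- s) = r powr s / (r ^ n * r)"
      "r powr (- s - 1) = r powr s / (r ^ n * r\<^sup>2)" "r > 0" "r powr s = r ^ l * r" "r ^ n = r ^ l * r ^ l * r"
      if "r \<in> {c<..<d}" for r
    proof -
      show r: "r > 0" using that c by auto
      have rn: "r powr (2 * s - 1) = r ^ n" using powr_realpow[OF r, of n] by (simp add: s_def n_def)
      show "r powr (s - 1) = r powr s / r" "r powr (s - 2) = r powr s / r\<^sup>2"
        using r by (simp_all add: powr_diff)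
      show "r powr (1 - s) = r powr s / r ^ n"
        unfolding rn[symmetric] using powr_diff[of r s "2 * s - 1"] by simp
      show "r powr (- s) = r powr s / (r ^ n * r)"
        unfolding rn[symmetric] using powr_diff[of r s "2 * s"] powr_diff[of r "2 * s" 1] r by simp
      show "r powr (- s - 1) = r powr s / (r ^ n * r\<^sup>2)"
        unfolding rn[symmetric] using powr_diff[of r s "2 * s + 1"] powr_diff[of r "2 * s + 1" 2] r by simp
      show "r powr s = r ^ l * r" using powr_of_nat_add_1[OF r, of l] by (simp add: s_def mult.commute)
      show "r ^ n = r ^ l * r ^ l * r" by (simp add: n_def mult_2 power_add)
    qed
    have qQ: "q r = r * Q r" for r by (simp add: q_def)
    have s2: "s * (s - 1) = real l * (real l + 1)" by (simp add: s_def)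
    have ns: "real n = 2 * s - 1" by (simp add: n_def s_def)
    have "has_ac_derivative (\<lambda>r. (1 / real n) * (r powr s * (real n + J1 r) + (- 1) * (r powr (1 - s) * J2 r)))
      (\<lambda>r. (1 / real n) * (r powr s * (q r * w r) + s * r powr (s - 1) * (real n + J1 r) +
        (- 1) * (r powr (1 - s) * (q r * (r ^ n * w r)) + (1 - s) * r powr (1 - s - 1) * J2 r))) c d"
      by (intro has_ac_derivative_add mul lin pw 1 acJ c)
    then show "has_ac_derivative y y' c d"
      by (rule has_ac_derivative_cong)
        (use n in \<open>auto simp: y_def y'_def rs divide_simps\<close>)
    have "has_ac_derivative (\<lambda>r. (1 / real n) * (s * (r powr (s - 1) * (real n + J1 r)) +
        (s - 1) * (r powr (- s) * J2 r)))
      (\<lambda>r. (1 / real n) * (s * (r powr (s - 1) * (q r * w r) + (s - 1) * r powr (s - 1 - 1) * (real n + J1 r)) +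
        (s - 1) * (r powr (- s) * (q r * (r ^ n * w r)) + (- s) * r powr (- s - 1) * J2 r))) c d"
      by (intro has_ac_derivative_add mul lin pw 1 acJ c)
    then show "has_ac_derivative y' (\<lambda>r. (real l * (real l + 1) / r\<^sup>2 + Q r) * y r) c d"
    proof (rule has_ac_derivative_cong)
      fix r assume r: "r \<in> {c<..<d}"
      note rr = rs[OF r]
      define P where "P = r powr s"
      have P: "r powr (s - 1) = P / r" "r powr (s - 1 - 1) = P / r\<^sup>2"
        "r powr (- s) = P / (r ^ n * r)" "r powr (- s - 1) = P / (r ^ n * r\<^sup>2)" "r powr (1 - s) = P / r ^ n"
        using rr by (simp_all add: P_def)
      have a: "Q r * y r = Q r * (P * w r)"
        using yw[of r] rr by (simp add: P_def mult_ac)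
      have b: "(real l * (real l + 1) / r\<^sup>2) * y r =
          (1 / real n) * (s * (s - 1) * (P / r\<^sup>2) * (real n + J1 r) - (s - 1) * s * (P / (r ^ n * r\<^sup>2)) * J2 r)"
        unfolding s2[symmetric] y_def P P_def[symmetric] using rr(6) n by (simp add: field_simps)
      \<comment> \<open>The second derivative meets the two integrands with weights \<open>s\<close>
        and \<open>s - 1\<close>, whose sum \<open>2 * s - 1\<close> is \<open>n\<close>.\<close>
      have c: "(1 / real n) * (s * (P / r * (q r * w r)) + (s - 1) * (P / (r ^ n * r) * (q r * (r ^ n * w r))))
          = Q r * (P * w r)"
      proof -
        have "s * (P / r * (q r * w r)) + (s - 1) * (P / (r ^ n * r) * (q r * (r ^ n * w r))) =
            (2 * s - 1) * (Q r * (P * w r))"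
          using rr(6) by (simp add: qQ field_simps)
        then show ?thesis using n by (simp add: ns[symmetric])
      qed
      have ring: "(1 / real n) * (s * (A + (s - 1) * X * Y) + (s - 1) * (B + (- s) * Z * J)) =
          (1 / real n) * (s * A + (s - 1) * B) + (1 / real n) * (s * (s - 1) * X * Y - (s - 1) * s * Z * J)"
        for A B X Y Z J
        by (simp add: algebra_simps)
      have "(1 / real n) * (s * (r powr (s - 1) * (q r * w r) + (s - 1) * r powr (s - 1 - 1) * (real n + J1 r)) +
          (s - 1) * (r powr (- s) * (q r * (r ^ n * w r)) + (- s) * r powr (- s - 1) * J2 r)) =
          Q r * (P * w r) + (real l * (real l + 1) / r\<^sup>2) * y r"
        unfolding P ring c b ..
      then show "(1 / real n) * (s * (r powr (s - 1) * (q r * w r) + (s - 1) * r powr (s - 1 - 1) * (real n + J1 r)) +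
          (s - 1) * (r powr (- s) * (q r * (r ^ n * w r)) + (- s) * r powr (- s - 1) * J2 r)) =
          (real l * (real l + 1) / r\<^sup>2 + Q r) * y r"
        unfolding a[symmetric] by (simp only: distrib_right add.commute)
    qed (use n in \<open>simp add: y'_def field_simps\<close>)
  qed
  \<comment> \<open>So far \<open>y'\<close> is the derivative only almost everywhere; as
    \<open>y\<close> is the integral of the continuous \<open>y'\<close>, it is so at every
    point.\<close>
  have "(y has_vector_derivative y' r) (at r)" if r: "r > 0" for r
  proof -
    have y'c: "continuous_on {r/2..r+1} y'" by (rule has_ac_derivative_continuous_on[OF acy']) (use r in auto)
    have "((\<lambda>x. integral {r/2..x} y') has_vector_derivative y' r) (at r within {r/2..r+1})"
      by (rule integral_has_vector_derivative[OF y'c]) (use r in auto)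
    then have "((\<lambda>x. integral {r/2..x} y' + y (r/2)) has_vector_derivative y' r) (at r)"
      using r by (simp add: at_within_Icc_at has_vector_derivative_add_const)
    then show ?thesis
    proof (rule has_vector_derivative_transform_within_open[of _ _ _ "{r/2<..<r+1}"])
      fix x assume x: "x \<in> {r/2<..<r+1}"
      have "(y' has_integral (y x - y (r/2))) {r/2..x}"
        by (rule has_ac_derivative_has_integral[OF acy]) (use x r in auto)
      then show "integral {r/2..x} y' + y (r/2) = y x" by (simp add: integral_unique)
    qed (use r in auto)
  qed
  then have "ode_solution (\<lambda>r. real l * (real l + 1) / r\<^sup>2 + Q r) y y'"
    using acy' by (simp add: ode_solution_def)
  moreover have "((\<lambda>r. y r / r ^ (l + 1)) \<longlongrightarrow> 1) (at_right 0)"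
  proof -
    have "w 0 = 1" using w[of 0] by (simp add: volterra_def)
    moreover have "(w \<longlongrightarrow> w 0) (at 0 within {0..})"
      using wc unfolding continuous_on_def by auto
    ultimately have "(w \<longlongrightarrow> 1) (at_right 0)" by (simp add: at_within_Ici_at_right)
    then show ?thesis
      by (rule Lim_transform_eventually[OF _ eventually_at_rightI[of 0 1]]) (use yw in auto)
  qed
  ultimately show ?thesis using that by blast
qed

end

section \<open>Asymptotics\<close>

text \<open>Gronwall's inequality for \<open>norm y + norm y'\<close>, with
  \<open>1 + \<bar>q\<bar>\<close> dominating the first-order system. It serves to exclude a common
  zero of the regular solution and its derivative.\<close>

lemma ode_solution_backward_unique:
  fixes y :: "real \<Rightarrow> 'a::euclidean_space"
  assumes y: "ode_solution q y y'" and q: "\<And>c d. 0 < c \<Longrightarrow> q absolutely_integrable_on {c..d}"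
    and zero: "y d = 0" "y' d = 0" and r: "0 < r" "r \<le> d"
  shows "y r = 0"
proof -
  define h where "h = (\<lambda>x. norm (y x) + norm (y' x))"
  define g where "g = (\<lambda>x. 1 + \<bar>q x\<bar>)"
  have yc: "continuous_on {r..d} y" "continuous_on {r..d} y'"
    using has_ac_derivative_continuous_on[OF ode_solution_has_ac_derivative[OF y r(1)]]
      has_ac_derivative_continuous_on[OF ode_solutionD(2)[OF y r(1)]] by auto
  have qi: "q absolutely_integrable_on {r..d}" using q r by blast
  have g: "g absolutely_integrable_on {r..d}"
    unfolding g_def by (intro set_integral_add(1) set_integrable_abs qi absolutely_integrable_continuous_real) simp
  have hc: "continuous_on {r..d} h" unfolding h_def by (intro continuous_intros yc)
  have gh: "(\<lambda>x. g x * h x) integrable_on {r..d}"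
    using absolutely_integrable_mult_continuous[OF g hc] set_lebesgue_integral_eq_integral(1) by blast
  have "bounded (h ` {r..d})"
    by (intro compact_imp_bounded compact_continuous_image hc compact_Icc)
  then obtain B where B: "\<And>x. x \<in> {r..d} \<Longrightarrow> norm (h x) \<le> B" by (metis bounded_iff image_eqI)
  have "h r \<le> 0"
  proof (rule gronwall_backward[where h = h and g = g and c = r and d = d and B = B, OF g _ gh])
    show "h x \<le> B" if "x \<in> {r..d}" for x using B[OF that] by simp
    show "h x \<le> integral {x..d} (\<lambda>s. g s * h s)" if x: "x \<in> {r..d}" for x
    proof -
      have x0: "0 < x" "x \<le> d" using x r by auto
      have "(y' has_integral (y d - y x)) {x..d}"
        by (rule has_ac_derivative_has_integral[OF ode_solution_has_ac_derivative[OF y x0(1)] x0(2)])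
      moreover have "((\<lambda>s. q s *\<^sub>R y s) has_integral (y' d - y' x)) {x..d}"
        by (rule has_ac_derivative_has_integral[OF ode_solutionD(2)[OF y x0(1)] x0(2)])
      moreover have ghx: "(\<lambda>x. g x * h x) integrable_on {x..d}"
        by (rule integrable_on_subinterval[OF gh]) (use x in auto)
      moreover have sub: "{x..d} \<subseteq> {r..d}" using x by auto
      have nq: "(\<lambda>s. norm (q s *\<^sub>R y s)) integrable_on {x..d}" "(\<lambda>s. norm (y' s)) integrable_on {x..d}"
      proof -
        have "(\<lambda>s. \<bar>q s\<bar> * norm (y s)) absolutely_integrable_on {x..d}"
          by (intro absolutely_integrable_mult_continuous set_integrable_abs
              absolutely_integrable_on_subinterval[OF qi sub] continuous_intros continuous_on_subset[OF yc(1) sub])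
        then show "(\<lambda>s. norm (q s *\<^sub>R y s)) integrable_on {x..d}"
          by (simp add: set_lebesgue_integral_eq_integral(1))
        show "(\<lambda>s. norm (y' s)) integrable_on {x..d}"
          by (intro integrable_continuous_real continuous_intros continuous_on_subset[OF yc(2) sub])
      qed
      ultimately have "norm (y d - y x) + norm (y' d - y' x) \<le>
          integral {x..d} (\<lambda>s. norm (y' s)) + integral {x..d} (\<lambda>s. norm (q s *\<^sub>R y s))"
        by (intro add_mono)
          (auto simp: has_integral_iff intro!: integral_norm_bound_integral dest!: sym[of "integral _ _"])
      also have "\<dots> = integral {x..d} (\<lambda>s. norm (y' s) + norm (q s *\<^sub>R y s))"
        using nq by (simp add: Henstock_Kurzweil_Integration.integral_add)
      also have "\<dots> \<le> integral {x..d} (\<lambda>s. g s * h s)"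
        by (rule integral_le[OF integrable_add[OF nq(2,1)] ghx]) (simp add: g_def h_def algebra_simps)
      finally show ?thesis using zero by (simp add: h_def)
    qed
  qed (use r in \<open>auto simp: g_def\<close>)
  moreover have "norm (y r) \<le> h r" by (simp add: h_def)
  ultimately have "norm (y r) \<le> 0" by linarith
  then show ?thesis by simp
qed

lemma integral_tendsto_at_top:
  fixes f :: "real \<Rightarrow> 'a::euclidean_space"
  assumes f: "f absolutely_integrable_on {a..}"
  shows "((\<lambda>t. integral {a..t} f) \<longlongrightarrow> integral {a..} f) at_top"
proof -
  have "((\<lambda>t. LINT x:{a..t}|lebesgue. f x) \<longlongrightarrow> (LINT x:{a..}|lebesgue. f x)) at_top"
    by (rule tendsto_set_lebesgue_integral_at_top[OF _ f]) auto
  moreover have "(LINT x:{a..t}|lebesgue. f x) = integral {a..t} f" for t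
    by (rule set_lebesgue_integral_eq_integral(2))
      (rule absolutely_integrable_on_subinterval[OF f], auto)
  ultimately show ?thesis using set_lebesgue_integral_eq_integral(2)[OF f] by simp
qed

lemma tendsto_zero_of_square_integrable:
  fixes f :: "real \<Rightarrow> real"
  assumes lim: "(f \<longlongrightarrow> c) at_top" and sq: "(\<lambda>r. \<bar>f r\<bar>\<^sup>2) absolutely_integrable_on {a..}"
  shows "c = 0"
proof (rule ccontr)
  assume "c \<noteq> 0"
  have fi: "(\<lambda>r. (f r)\<^sup>2) integrable_on {a..}"
    using set_lebesgue_integral_eq_integral(1)[OF sq] by simp
  have "((\<lambda>r. (f r)\<^sup>2) \<longlongrightarrow> c\<^sup>2) at_top" by (intro tendsto_intros lim)
  moreover have "c\<^sup>2 / 2 < c\<^sup>2" using \<open>c \<noteq> 0\<close> by simp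
  ultimately have "\<forall>\<^sub>F r in at_top. c\<^sup>2 / 2 < (f r)\<^sup>2" by (rule order_tendstoD(1))
  then obtain R where R: "\<And>r. r \<ge> R \<Longrightarrow> c\<^sup>2 / 2 < (f r)\<^sup>2" by (auto simp: eventually_at_top_linorder)
  define b where "b = max a R"
  \<comment> \<open>So long an interval that the lower bound \<open>c\<^sup>2 / 2\<close> alone
    integrates to more than the total.\<close>
  define t where "t = b + (integral {a..} (\<lambda>r. (f r)\<^sup>2) + 1) / (c\<^sup>2 / 2)"
  have "0 \<le> integral {a..} (\<lambda>r. (f r)\<^sup>2)" by (rule integral_nonneg[OF fi]) simp
  then have bt: "b \<le> t" by (simp add: t_def)
  have fbt: "(\<lambda>r. (f r)\<^sup>2) integrable_on {b..t}"
    by (rule integrable_on_subinterval[OF fi]) (auto simp: b_def)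
  have "integral {a..} (\<lambda>r. (f r)\<^sup>2) + 1 = integral {b..t} (\<lambda>r. c\<^sup>2 / 2)"
    using bt \<open>c \<noteq> 0\<close> by (simp add: t_def)
  also have "\<dots> \<le> integral {b..t} (\<lambda>r. (f r)\<^sup>2)"
    by (rule integral_le[OF _ fbt]) (use R in \<open>auto simp: b_def intro: less_imp_le\<close>)
  also have "\<dots> \<le> integral {a..} (\<lambda>r. (f r)\<^sup>2)"
    by (rule integral_subset_le[OF _ fbt fi]) (auto simp: b_def)
  finally show False by simp
qed

text \<open>
  Integrating from either end shows that the maximum of \<open>norm f\<close> over an interval is at most twice
  every value, so \<open>f\<close> is bounded and bounded away from zero.
\<close>

lemma ac_levinson_limit:
  fixes f :: "real \<Rightarrow> 'a::euclidean_space"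
  assumes f: "\<And>d. has_ac_derivative f f' b d"
    and f': "\<And>r. r \<ge> b \<Longrightarrow> norm (f' r) \<le> g r * norm (f r)"
    and g: "g absolutely_integrable_on {b..}" "\<And>r. r \<ge> b \<Longrightarrow> 0 \<le> g r"
    and small: "\<And>t. integral {b..t} g \<le> 1/2" and nz: "f b \<noteq> 0"
  obtains L where "(f \<longlongrightarrow> L) at_top" "L \<noteq> 0"
proof -
  have gi: "g integrable_on {b..}" using g(1) set_lebesgue_integral_eq_integral(1) by blast
  have gst: "g integrable_on {s..t}" if "b \<le> s" for s t
    by (rule integrable_on_subinterval[OF gi]) (use that in auto)
  have fi: "(f' has_integral (f t - f s)) {s..t}" if "b \<le> s" "s \<le> t" for s t
    by (rule has_ac_derivative_has_integral[OF has_ac_derivative_subinterval[OF f[of t]]]) (use that in auto)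
  have incr: "norm (f t - f s) \<le> M * integral {s..t} g"
    if st: "b \<le> s" "s \<le> t" and M: "\<And>x. s \<le> x \<Longrightarrow> x \<le> t \<Longrightarrow> norm (f x) \<le> M" for s t M
  proof -
    have "norm (integral {s..t} f') \<le> integral {s..t} (\<lambda>x. M * g x)"
    proof (rule integral_norm_bound_integral)
      show "f' integrable_on {s..t}" using fi[OF st] by auto
      show "(\<lambda>x. M * g x) integrable_on {s..t}" using gst[OF st(1)] by (rule integrable_on_mult_right)
      fix x assume x: "x \<in> {s..t}"
      have "norm (f' x) \<le> g x * norm (f x)" using f' x st by auto
      also have "\<dots> \<le> g x * M" using g(2) M x st by (intro mult_left_mono) auto
      finally show "norm (f' x) \<le> M * g x" by (simp add: mult.commute)
    qed
    then show ?thesis using integral_unique[OF fi[OF st]] by simp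
  qed
  have comp: "norm (f x) \<le> 2 * norm (f z)" if xz: "x \<in> {b..t}" "z \<in> {b..t}" for x z t
  proof -
    have "continuous_on {b..t} (\<lambda>x. norm (f x))"
      by (intro continuous_intros has_ac_derivative_continuous_on[OF f])
    moreover have "{b..t} \<noteq> {}" using xz by auto
    ultimately obtain w where w: "w \<in> {b..t}" "\<And>y. y \<in> {b..t} \<Longrightarrow> norm (f y) \<le> norm (f w)"
      using continuous_attains_sup[OF compact_Icc, of b t "\<lambda>x. norm (f x)"] by blast
    have half: "norm (f v - f u) \<le> norm (f w) / 2" if "u \<in> {b..t}" "v \<in> {b..t}" "u \<le> v" for u v
    proof -
      have "norm (f v - f u) \<le> norm (f w) * integral {u..v} g"
        by (rule incr) (use that w in auto)
      also have "integral {u..v} g \<le> integral {b..v} g"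
        by (rule integral_subset_le) (use that gst g(2) in auto)
      then have "norm (f w) * integral {u..v} g \<le> norm (f w) * (1/2)"
        using small[of v] by (intro mult_left_mono) auto
      finally show ?thesis by simp
    qed
    have "norm (f w - f z) \<le> norm (f w) / 2"
      using half[of w z] half[of z w] w(1) xz(2) by (cases "w \<le> z") (auto simp: norm_minus_commute)
    moreover have "norm (f w) \<le> norm (f w - f z) + norm (f z)"
      using norm_triangle_ineq[of "f w - f z" "f z"] by simp
    ultimately have "norm (f w) \<le> 2 * norm (f z)" by simp
    then show ?thesis using w(2)[OF xz(1)] by simp
  qed
  have bound: "norm (f' x) \<le> 2 * norm (f b) * g x" if x: "x \<in> {b..}" for x
  proof -
    have "norm (f' x) \<le> g x * norm (f x)" using f' x by auto
    also have "\<dots> \<le> g x * (2 * norm (f b))" using g(2) x comp[of x x b] by (intro mult_left_mono) auto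
    finally show ?thesis by (simp add: mult_ac)
  qed
  have bg: "(\<lambda>x. 2 * norm (f b) * g x) integrable_on {b..}" using gi by (rule integrable_on_mult_right)
  \<comment> \<open>Each bounded interval is covered by the fundamental theorem; the majorant from
    \<open>comp\<close> passes to the half-line.\<close>
  have "f' integrable_on {b..}"
  proof (rule integrable_on_all_intervals_integrable_bound[OF _ bound bg])
    fix c d :: real
    have "f' integrable_on {max b c..d}"
      using fi[of "max b c" d] by (cases "max b c \<le> d") auto
    moreover have "{b..} \<inter> {c..d} = {max b c..d}" by auto
    ultimately show "(\<lambda>x. if x \<in> {b..} then f' x else 0) integrable_on cbox c d"
      by (simp only: box_real integrable_restrict_Int)
  qed
  from absolutely_integrable_integrable_bound[OF bound this bg]
  have f'i: "f' absolutely_integrable_on {b..}" by simp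
  define L where "L = f b + integral {b..} f'"
  have "((\<lambda>t. f b + integral {b..t} f') \<longlongrightarrow> L) at_top"
    unfolding L_def by (intro tendsto_intros integral_tendsto_at_top f'i)
  moreover have "\<forall>\<^sub>F t in at_top. f b + integral {b..t} f' = f t"
    using eventually_ge_at_top[of b]
  proof eventually_elim
    case (elim t)
    show ?case using integral_unique[OF fi[OF order_refl elim]] by simp
  qed
  ultimately have L: "(f \<longlongrightarrow> L) at_top" by (rule Lim_transform_eventually)
  have "norm (f b) / 2 \<le> norm L"
  proof (rule tendsto_lowerbound[OF tendsto_norm[OF L]])
    show "\<forall>\<^sub>F t in at_top. norm (f b) / 2 \<le> norm (f t)"
      using eventually_ge_at_top[of b]
    proof eventually_elim
      case (elim t)
      show ?case using comp[of b t t] elim by simp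
    qed
  qed simp
  then have "L \<noteq> 0" using nz by auto
  then show ?thesis using that L by blast
qed

lemma ode_solution_linear:
  fixes y :: "real \<Rightarrow> 'a::euclidean_space" and h :: "'a \<Rightarrow> 'b::euclidean_space"
  assumes h: "bounded_linear h" and y: "ode_solution q y y'"
  shows "ode_solution q (\<lambda>r. h (y r)) (\<lambda>r. h (y' r))"
  unfolding ode_solution_def
proof (intro conjI allI impI)
  interpret bounded_linear h by (rule h)
  show "((\<lambda>r. h (y r)) has_vector_derivative h (y' r)) (at r)" if "r > 0" for r
    using ode_solutionD(1)[OF y that] by (rule has_vector_derivative)
  show "has_ac_derivative (\<lambda>r. h (y' r)) (\<lambda>r. q r *\<^sub>R h (y r)) c d" if "0 < c" for c d
    using has_ac_derivative_linear[OF h ode_solutionD(2)[OF y that]] by (simp add: scaleR)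
qed

lemma ode_solution_add:
  assumes y: "ode_solution q y y'" and z: "ode_solution q z z'"
  shows "ode_solution q (\<lambda>r. y r + z r) (\<lambda>r. y' r + z' r)"
  unfolding ode_solution_def
proof (intro conjI allI impI)
  show "((\<lambda>r. y r + z r) has_vector_derivative y' r + z' r) (at r)" if "r > 0" for r
    using ode_solutionD(1)[OF y that] ode_solutionD(1)[OF z that] by (rule has_vector_derivative_add)
  show "has_ac_derivative (\<lambda>r. y' r + z' r) (\<lambda>r. q r *\<^sub>R (y r + z r)) c d" if "0 < c" for c d
    using has_ac_derivative_add[OF ode_solutionD(2)[OF y that] ode_solutionD(2)[OF z that]]
    by (simp add: scaleR_add_right)
qed

lemma has_ac_derivative_cis:
  assumes der: "\<And>r. r \<in> {c..d} \<Longrightarrow> (f has_vector_derivative f' r) (at r within {c..d})"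
    and cont: "continuous_on {c..d} f'"
  shows "has_ac_derivative (\<lambda>r. cis (f r)) (\<lambda>r. \<i> * complex_of_real (f' r) * cis (f r)) c d"
proof (rule has_ac_derivative_C1)
  fix r assume r: "r \<in> {c..d}"
  have "(f has_derivative (\<lambda>t. t *\<^sub>R f' r)) (at r within {c..d})"
    using der[OF r] by (simp add: has_vector_derivative_def)
  from has_derivative_cis[OF this]
  show "((\<lambda>r. cis (f r)) has_vector_derivative \<i> * complex_of_real (f' r) * cis (f r)) (at r within {c..d})"
    by (simp add: has_vector_derivative_def scaleR_conv_of_real mult_ac)
next
  have "continuous_on {c..d} f"
    unfolding continuous_on_eq_continuous_within
    using has_vector_derivative_continuous[OF der] by blast
  then show "continuous_on {c..d} (\<lambda>r. \<i> * complex_of_real (f' r) * cis (f r))"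
    by (intro continuous_intros cont)
qed

lemma locally_absolutely_continuous_fun_on_Ici:
  "locally_absolutely_continuous_fun_on {a..} f \<Longrightarrow> a \<le> c \<Longrightarrow> absolutely_continuous_fun_on {c..d} f"
  unfolding locally_absolutely_continuous_fun_on_def
  using absolutely_continuous_fun_on_subinterval[of "{a..d}" f "{c..d}"] by auto

section \<open>The potential at infinity and the amplitude of a real solution\<close>

context
  fixes l :: nat and k a :: real and \<phi> \<phi>' :: "real \<Rightarrow> real"
  assumes k: "k > 0" and a: "a > 0"
    and \<phi>ac: "locally_absolutely_continuous_fun_on {a..} \<phi>"
    and \<phi>der: "AE r in lebesgue. r > a \<longrightarrow> (\<phi> has_real_derivative \<phi>' r) (at r)"
    and \<phi>'int: "\<phi>' absolutely_integrable_on {a..}"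
    and \<phi>sq: "(\<lambda>r. \<bar>\<phi> r\<bar>\<^sup>2) absolutely_integrable_on {a..}"
begin

lemma potential_has_ac_derivative:
  assumes "a \<le> c" shows "has_ac_derivative \<phi> \<phi>' c d"
proof -
  obtain N where "N \<in> null_sets lebesgue"
    and N: "{r. \<not> (r > a \<longrightarrow> (\<phi> has_real_derivative \<phi>' r) (at r))} \<subseteq> N"
    using \<phi>der unfolding eventually_ae_filter by auto
  then have "negligible N" by (simp add: negligible_iff_null_sets)
  then show ?thesis
  proof (rule has_ac_derivativeI[OF locally_absolutely_continuous_fun_on_Ici[OF \<phi>ac assms]])
    fix x assume "x \<in> {c<..<d} - N"
    then have "x > a" "x \<notin> N" using assms by auto
    then show "(\<phi> has_vector_derivative \<phi>' x) (at x)"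
      using subsetD[OF N, of x] by (auto simp: has_real_derivative_iff_has_vector_derivative)
  qed
qed

lemma potential_continuous_on: "a \<le> c \<Longrightarrow> continuous_on {c..d} \<phi>"
  using has_ac_derivative_continuous_on potential_has_ac_derivative by blast

lemma potential_tendsto_0: "(\<phi> \<longlongrightarrow> 0) at_top"
proof -
  have "((\<lambda>t. \<phi> a + integral {a..t} \<phi>') \<longlongrightarrow> \<phi> a + integral {a..} \<phi>') at_top"
    by (intro tendsto_intros integral_tendsto_at_top \<phi>'int)
  moreover have "\<forall>\<^sub>F t in at_top. \<phi> a + integral {a..t} \<phi>' = \<phi> t"
    using eventually_ge_at_top[of a]
  proof eventually_elim
    case (elim t)
    then show ?case
      using has_ac_derivative_has_integral[OF potential_has_ac_derivative[of a t] elim]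
      by (simp add: integral_unique)
  qed
  ultimately have "(\<phi> \<longlongrightarrow> \<phi> a + integral {a..} \<phi>') at_top" by (rule Lim_transform_eventually)
  then show ?thesis using tendsto_zero_of_square_integrable[OF _ \<phi>sq] by metis
qed

text \<open>The potential is real, so the factor is unimodular and its inverse is its conjugate;
  beyond \<open>a\<close> the potential is continuous and the two notions of integral agree.\<close>

lemma deviation_factor_eq:
  assumes "a \<le> r"
  shows "deviation_factor \<phi> a r k = cis (integral {a..r} \<phi> / (2 * k))"
proof -
  have "\<phi> absolutely_integrable_on {a<..<r}"
    unfolding absolutely_integrable_on_Icc_iff_Ioo[symmetric]
    by (intro absolutely_integrable_continuous_real potential_continuous_on) simp
  then have "interval_lebesgue_integral lebesgue (ereal a) (ereal r) \<phi> = integral {a..r} \<phi>"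
    using assms by (simp add: interval_lebesgue_integral_le_eq set_lebesgue_integral_eq_integral(2)
        integral_open_interval_real)
  then show ?thesis by (simp add: deviation_factor_def cis_conv_exp)
qed

text \<open>
  The amplitude \<open>(y' + i m y) exp (-i (k r + \<Phi>/2k))\<close> with local wave number \<open>m = k + \<phi>/2k\<close>, which is
  the derivative of the phase, varies slowly: in its derivative the oscillating terms of order
  \<open>\<phi>\<close> cancel, and what remains is integrable at infinity.
\<close>

lemma real_ode_solution_asymptotics:
  assumes y: "ode_solution (radial_coeff l k \<phi>) y y'"
    and nz: "\<And>r. r > 0 \<Longrightarrow> y r \<noteq> 0 \<or> y' r \<noteq> 0"
  obtains A :: complex where "A \<noteq> 0"
    "((\<lambda>r. y r - Im (A * (cis (k * r) * deviation_factor \<phi> a r k)) / k) \<longlongrightarrow> 0) at_top"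
proof -
  define L where "L = real l * (real l + 1)"
  define m where "m = (\<lambda>r. k + \<phi> r / (2 * k))"
  define \<psi> where "\<psi> = (\<lambda>r. k * r + integral {a..r} \<phi> / (2 * k))"
  define p where "p = (\<lambda>r. cis (\<psi> r))"
  define Z where "Z = (\<lambda>r. complex_of_real (y' r) + \<i> * complex_of_real (m r * y r))"
  define \<alpha> where "\<alpha> = (\<lambda>r. Z r * cnj (p r))"
  define \<alpha>' where "\<alpha>' = (\<lambda>r. complex_of_real (y r) *
    (complex_of_real (L / r\<^sup>2 + (\<phi> r)\<^sup>2 / (4 * k\<^sup>2)) + \<i> * complex_of_real (\<phi>' r / (2 * k))) * cnj (p r))"
  define g0 where "g0 = (\<lambda>r. L / r\<^sup>2 + (\<phi> r)\<^sup>2 / (4 * k\<^sup>2) + \<bar>\<phi>' r\<bar> / (2 * k))"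
  \<comment> \<open>Once \<open>m > k / 2\<close>, \<open>\<bar>y\<bar>\<close> is at most
    \<open>2 / k\<close> times the modulus of \<open>\<alpha>\<close>; this turns the bound by
    \<open>\<bar>y\<bar> * g0\<close> into one by \<open>\<alpha>\<close> itself.\<close>
  define g where "g = (\<lambda>r. g0 r * (2 / k))"
  have L0: "L \<ge> 0" by (simp add: L_def)
  have g0: "g0 r \<ge> 0" for r using k L0 by (simp add: g0_def)
  have g_nonneg: "g r \<ge> 0" for r using k g0[of r] by (simp add: g_def)
  have gi: "g absolutely_integrable_on {a..}"
  proof -
    have "(\<lambda>r. 1 / r\<^sup>2) absolutely_integrable_on {a..}"
      using has_integral_inverse_power_to_inf[of 2 a] a
      by (intro nonnegative_absolutely_integrable_1) auto
    then have "(\<lambda>r. L * (1 / r\<^sup>2) + \<bar>\<phi> r\<bar>\<^sup>2 / (4 * k\<^sup>2) + \<bar>\<phi>' r\<bar> / (2 * k)) absolutely_integrable_on {a..}"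
      by (intro set_integral_add(1) set_integrable_mult_right set_integrable_divide \<phi>sq set_integrable_abs \<phi>'int)
    then have "g0 absolutely_integrable_on {a..}" by (simp add: g0_def)
    then show ?thesis unfolding g_def by (intro set_integrable_mult_left)
  qed
  have \<psi>': "(\<psi> has_vector_derivative m r) (at r within {c..d})" if "a \<le> c" "r \<in> {c..d}" for c d r
  proof -
    have "((\<lambda>x. integral {a..x} \<phi>) has_vector_derivative \<phi> r) (at r within {a..d})"
      by (rule integral_has_vector_derivative[OF potential_continuous_on]) (use that in auto)
    then have "((\<lambda>x. integral {a..x} \<phi>) has_real_derivative \<phi> r) (at r within {c..d})"
      unfolding has_real_derivative_iff_has_vector_derivative
      by (rule has_vector_derivative_within_subset) (use that in auto)
    then have "(\<psi> has_real_derivative k * 1 + \<phi> r / (2 * k)) (at r within {c..d})"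
      unfolding \<psi>_def by (intro DERIV_add DERIV_cmult DERIV_ident DERIV_cdivide)
    then show ?thesis by (simp add: m_def has_real_derivative_iff_has_vector_derivative)
  qed
  have mac: "has_ac_derivative m (\<lambda>r. \<phi>' r / (2 * k)) c d" if "a \<le> c" for c d
    using has_ac_derivative_add[OF has_ac_derivative_C1[of c d "\<lambda>_. k" "\<lambda>_. 0"]
        has_ac_derivative_linear[OF bounded_linear_divide potential_has_ac_derivative[OF that, of d]]]
    by (simp add: m_def)
  have \<alpha>ac: "has_ac_derivative \<alpha> \<alpha>' c d" if c: "a \<le> c" for c d
  proof -
    have c0: "0 < c" using a c by simp
    have pac: "has_ac_derivative p (\<lambda>r. \<i> * complex_of_real (m r) * p r) c d"
      unfolding p_def using \<psi>'[OF c]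
      by (rule has_ac_derivative_cis) (auto intro: has_ac_derivative_continuous_on[OF mac[OF c]])
    have "has_ac_derivative (\<lambda>r. complex_of_real (y' r)) (\<lambda>r. complex_of_real (radial_coeff l k \<phi> r * y r)) c d"
      using has_ac_derivative_linear[OF bounded_linear_of_real ode_solutionD(2)[OF y c0, of d]] by simp
    moreover have "has_ac_derivative (\<lambda>r. \<i> * complex_of_real (m r * y r))
        (\<lambda>r. \<i> * complex_of_real (m r * y' r + \<phi>' r / (2 * k) * y r)) c d"
      by (intro has_ac_derivative_linear[OF bounded_linear_mult_right]
          has_ac_derivative_linear[OF bounded_linear_of_real]
          has_ac_derivative_mult mac c ode_solution_has_ac_derivative[OF y c0])
    ultimately have "has_ac_derivative Z (\<lambda>r. complex_of_real (radial_coeff l k \<phi> r * y r) +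
        \<i> * complex_of_real (m r * y' r + \<phi>' r / (2 * k) * y r)) c d"
      unfolding Z_def by (rule has_ac_derivative_add)
    from has_ac_derivative_mult[OF this has_ac_derivative_linear[OF bounded_linear_cnj pac]]
    show ?thesis
    proof (rule has_ac_derivative_cong)
      fix r assume "r \<in> {c<..<d}"
      \<comment> \<open>Completing the square: the term \<open>- (m r)\<^sup>2\<close> and the term
        with \<open>m r * y' r\<close> cancel against the derivative of the phase factor.\<close>
      have q: "radial_coeff l k \<phi> r = L / r\<^sup>2 + (\<phi> r)\<^sup>2 / (4 * k\<^sup>2) - (m r)\<^sup>2"
      proof -
        have "(m r)\<^sup>2 = k\<^sup>2 + \<phi> r + (\<phi> r)\<^sup>2 / (4 * k\<^sup>2)"
          using k by (simp add: m_def power2_eq_square field_simps)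
        then show ?thesis by (simp add: radial_coeff_def L_def)
      qed
      show "Z r * cnj (\<i> * complex_of_real (m r) * p r) +
          (complex_of_real (radial_coeff l k \<phi> r * y r) +
           \<i> * complex_of_real (m r * y' r + \<phi>' r / (2 * k) * y r)) * cnj (p r) = \<alpha>' r"
        unfolding q Z_def \<alpha>'_def by (simp add: algebra_simps power2_eq_square)
    qed (simp add: \<alpha>_def)
  qed
  have norm_p: "cmod (p r) = 1" for r by (simp add: p_def)
  have pp: "p r * cnj (p r) = 1" for r
    using norm_p by (simp add: complex_norm_square[symmetric])
  have Z\<alpha>: "Z r = \<alpha> r * p r" for r using pp[of r] by (simp add: \<alpha>_def mult.assoc mult.commute)
  have norm_\<alpha>: "cmod (\<alpha> r) = cmod (Z r)" for r by (simp add: \<alpha>_def norm_mult norm_p)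
  have my: "m r * y r = Im (\<alpha> r * p r)" for r by (simp add: Z\<alpha>[symmetric] Z_def)
  have mlim: "(m \<longlongrightarrow> k) at_top"
  proof -
    have "(m \<longlongrightarrow> k + 0 / (2 * k)) at_top" unfolding m_def using k
      by (intro tendsto_intros potential_tendsto_0) auto
    then show ?thesis by simp
  qed
  then have "\<forall>\<^sub>F r in at_top. k / 2 < m r" by (rule order_tendstoD(1)) (use k in simp)
  then obtain b1 where b1: "\<And>r. r \<ge> b1 \<Longrightarrow> k / 2 < m r" by (auto simp: eventually_at_top_linorder)
  have "\<forall>\<^sub>F t in at_top. integral {a..} g - 1/2 < integral {a..t} g"
    by (rule order_tendstoD(1)[OF integral_tendsto_at_top[OF gi]]) simp
  then obtain b2 where b2: "\<And>t. t \<ge> b2 \<Longrightarrow> integral {a..} g - 1/2 < integral {a..t} g"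
    by (auto simp: eventually_at_top_linorder)
  \<comment> \<open>Beyond \<open>b\<close> the wave number exceeds \<open>k / 2\<close> and the
    tail of \<open>g\<close> is below the threshold one half of
    \<open>ac_levinson_limit\<close>.\<close>
  define b where "b = max a (max b1 b2)"
  have b: "a \<le> b" "b1 \<le> b" "b2 \<le> b" by (auto simp: b_def)
  have gi': "g integrable_on {a..}" using gi set_lebesgue_integral_eq_integral(1) by blast
  have small: "integral {b..t} g \<le> 1/2" for t
  proof (cases "b \<le> t")
    case True
    have gt: "g integrable_on {a..t}" by (rule integrable_on_subinterval[OF gi']) auto
    have "integral {a..b} g + integral {b..t} g = integral {a..t} g"
      using b True gt by (intro Henstock_Kurzweil_Integration.integral_combine) auto
    moreover have "integral {a..t} g \<le> integral {a..} g"
      by (rule integral_subset_le[OF _ gt gi']) (use g_nonneg in auto)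
    ultimately show ?thesis using b2[OF b(3)] by simp
  qed simp
  have \<alpha>'_le: "cmod (\<alpha>' r) \<le> g r * cmod (\<alpha> r)" if r: "r \<ge> b" for r
  proof -
    have mr: "k / 2 < m r" using b1 b r by simp
    have "k / 2 * \<bar>y r\<bar> \<le> m r * \<bar>y r\<bar>" using mr by (intro mult_right_mono) auto
    also have "\<dots> = \<bar>Im (\<alpha> r * p r)\<bar>" using mr k unfolding my[symmetric] by (simp add: abs_mult)
    also have "\<dots> \<le> cmod (\<alpha> r)" using abs_Im_le_cmod[of "\<alpha> r * p r"] by (simp add: norm_mult norm_p)
    finally have yr: "\<bar>y r\<bar> \<le> (2 / k) * cmod (\<alpha> r)" using k by (simp add: field_simps)
    have "cmod (complex_of_real (L / r\<^sup>2 + (\<phi> r)\<^sup>2 / (4 * k\<^sup>2)) + \<i> * complex_of_real (\<phi>' r / (2 * k))) \<le>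
        cmod (complex_of_real (L / r\<^sup>2 + (\<phi> r)\<^sup>2 / (4 * k\<^sup>2))) + cmod (\<i> * complex_of_real (\<phi>' r / (2 * k)))"
      by (rule norm_triangle_ineq)
    also have "\<dots> = g0 r"
      unfolding norm_mult norm_of_real using L0 k by (simp add: g0_def)
    finally have "cmod (\<alpha>' r) \<le> \<bar>y r\<bar> * g0 r"
      unfolding \<alpha>'_def norm_mult by (simp add: norm_p mult_left_mono)
    also have "\<dots> \<le> ((2 / k) * cmod (\<alpha> r)) * g0 r" using yr g0 by (rule mult_right_mono)
    finally show ?thesis by (simp add: g_def mult_ac)
  qed
  have "\<alpha> b \<noteq> 0"
  proof
    assume "\<alpha> b = 0"
    then have "Z b = 0" by (simp add: Z\<alpha>)
    then have "y' b = 0" "m b * y b = 0" by (simp_all add: Z_def complex_eq_iff)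
    moreover have "m b > 0" using b1[OF b(2)] k by simp
    ultimately show False using nz[of b] a b by simp
  qed
  moreover have "g absolutely_integrable_on {b..}"
    by (rule set_integrable_subset[OF gi]) (use b in auto)
  ultimately obtain A where A: "(\<alpha> \<longlongrightarrow> A) at_top" "A \<noteq> 0"
    using ac_levinson_limit[OF \<alpha>ac[OF b(1)] \<alpha>'_le] g_nonneg small by metis
  \<comment> \<open>The two errors made in replacing \<open>\<alpha>\<close> by its limit and then
    \<open>m\<close> by \<open>k\<close>; \<open>p\<close> stays on the unit circle and does no
    harm.\<close>
  have "((\<lambda>r. Im ((\<alpha> r - A) * p r) / m r + Im (A * p r) * (1 / m r - 1 / k)) \<longlongrightarrow> 0) at_top"
  proof -
    have "((\<lambda>r. \<alpha> r - A) \<longlongrightarrow> A - A) at_top" by (intro tendsto_intros A)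
    then have "((\<lambda>r. cmod (\<alpha> r - A)) \<longlongrightarrow> 0) at_top" using tendsto_norm_zero by simp
    then have "((\<lambda>r. Im ((\<alpha> r - A) * p r)) \<longlongrightarrow> 0) at_top"
      by (rule Lim_null_comparison[rotated])
        (use abs_Im_le_cmod[of "(\<alpha> _ - A) * p _"] in \<open>simp add: norm_mult norm_p\<close>)
    then have 1: "((\<lambda>r. Im ((\<alpha> r - A) * p r) / m r) \<longlongrightarrow> 0 / k) at_top"
      using k by (intro tendsto_divide mlim) auto
    have "((\<lambda>r. cmod A * \<bar>1 / m r - 1 / k\<bar>) \<longlongrightarrow> cmod A * \<bar>1 / k - 1 / k\<bar>) at_top"
      using k by (intro tendsto_intros mlim) auto
    then have "((\<lambda>r. cmod A * \<bar>1 / m r - 1 / k\<bar>) \<longlongrightarrow> 0) at_top" by simp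
    then have 2: "((\<lambda>r. Im (A * p r) * (1 / m r - 1 / k)) \<longlongrightarrow> 0) at_top"
      by (rule Lim_null_comparison[rotated])
        (use abs_Im_le_cmod[of "A * p _"] in \<open>simp add: norm_mult norm_p abs_mult mult_right_mono\<close>)
    show ?thesis using tendsto_add[OF 1 2] by simp
  qed
  moreover have "\<forall>\<^sub>F r in at_top. Im ((\<alpha> r - A) * p r) / m r + Im (A * p r) * (1 / m r - 1 / k) =
      y r - Im (A * (cis (k * r) * deviation_factor \<phi> a r k)) / k"
    using eventually_ge_at_top[of b]
  proof eventually_elim
    case (elim r)
    have "m r > 0" using b1[of r] k elim b by simp
    then have yr: "y r = Im (\<alpha> r * p r) / m r" using my[of r] by (simp add: field_simps)
    have cis: "cis (k * r) * deviation_factor \<phi> a r k = p r"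
      using deviation_factor_eq[of r] elim b by (simp add: p_def \<psi>_def cis_mult)
    have "Im ((\<alpha> r - A) * p r) = Im (\<alpha> r * p r) - Im (A * p r)"
      by (simp add: algebra_simps)
    then show ?case
      unfolding cis yr by (simp del: times_complex.sel add: algebra_simps diff_divide_distrib)
  qed
  ultimately have "((\<lambda>r. y r - Im (A * (cis (k * r) * deviation_factor \<phi> a r k)) / k) \<longlongrightarrow> 0) at_top"
    by (rule Lim_transform_eventually)
  then show ?thesis using that A(2) by blast
qed

end

section \<open>Normalization of the regular solution and the scattering function\<close>

theorem proposition4p1:
  fixes l :: nat and k a :: real and \<phi> \<phi>' :: "real \<Rightarrow> real"
  assumes "k > 0" and "a > 0"
    and "locally_absolutely_continuous_fun_on {a..} \<phi>"
    and "AE r in lebesgue. r > a \<longrightarrow> (\<phi> has_real_derivative \<phi>' r) (at r)"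
    and "\<phi>' absolutely_integrable_on {a..}"
    and "(\<lambda>r. \<bar>\<phi> r\<bar>\<^sup>2) absolutely_integrable_on {a..}"
    and "(\<lambda>r. \<phi> r * r) absolutely_integrable_on {0<..<a}"
  shows "\<exists>N S :: complex. N \<noteq> 0 \<and>
    (\<exists>y. regular_solution l k \<phi> N y \<and>
      (\<forall>z. regular_solution l k \<phi> N z \<longrightarrow> (\<forall>r>0. z r = y r)) \<and>
      ((\<lambda>r. y r -
          (exp (- (\<i> * complex_of_real (phase l k r))) * inverse (deviation_factor \<phi> a r k)
           - exp (\<i> * complex_of_real (phase l k r)) * deviation_factor \<phi> a r k * S))
        \<longlongrightarrow> 0) at_top)"
proof -
  note k = assms(1) and a = assms(2)
  \<comment> \<open>All but the centrifugal term counts as perturbation, so the comparison equation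
    has powers as solutions.\<close>
  define Q where "Q = (\<lambda>r. - \<phi> r - k\<^sup>2)"
  have coeff: "radial_coeff l k \<phi> = (\<lambda>r. real l * (real l + 1) / r\<^sup>2 + Q r)"
    by (simp add: radial_coeff_def Q_def fun_eq_iff)
  have cont: "continuous_on {c..d} \<phi>" if "a \<le> c" for c d
    by (intro absolutely_continuous_fun_on_imp_continuous_on locally_absolutely_continuous_fun_on_Ici[OF assms(3) that])
  have \<phi>t: "(\<lambda>t. \<phi> t * t) absolutely_integrable_on {0..R}" for R
  proof -
    have "(\<lambda>t. \<phi> t * t) absolutely_integrable_on {0..a}"
      using assms(7) by (simp add: absolutely_integrable_on_Icc_iff_Ioo)
    moreover have "(\<lambda>t. \<phi> t * t) absolutely_integrable_on {a..max a R}"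
      by (intro absolutely_integrable_continuous_real continuous_intros cont) simp
    ultimately have "(\<lambda>t. \<phi> t * t) absolutely_integrable_on {0..max a R}"
      by (rule absolutely_integrable_on_combine) (use a in auto)
    then show ?thesis by (rule absolutely_integrable_on_subinterval) auto
  qed
  have Qt: "(\<lambda>t. t * Q t) absolutely_integrable_on {0..R}" for R
  proof -
    have "(\<lambda>t. k\<^sup>2 * t) absolutely_integrable_on {0..R}"
      by (intro absolutely_integrable_continuous_real continuous_intros)
    from set_integral_diff(1)[OF set_integrable_mult_right[of "- 1 :: real", OF \<phi>t] this]
    show ?thesis by (simp add: Q_def algebra_simps)
  qed
  have q: "radial_coeff l k \<phi> absolutely_integrable_on {c..d}" if c: "0 < c" for c d
  proof -
    have "(\<lambda>t. t * Q t) absolutely_integrable_on {c..d}"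
      by (rule absolutely_integrable_on_subinterval[OF Qt[of d]]) (use c in auto)
    then have "(\<lambda>t. t * Q t * (1 / t)) absolutely_integrable_on {c..d}"
      by (rule absolutely_integrable_mult_continuous) (use c in \<open>auto intro!: continuous_intros\<close>)
    moreover have "(\<lambda>t. real l * (real l + 1) / t\<^sup>2) absolutely_integrable_on {c..d}"
      using c by (intro absolutely_integrable_continuous_real continuous_intros) auto
    ultimately have "(\<lambda>t. real l * (real l + 1) / t\<^sup>2 + t * Q t * (1 / t)) absolutely_integrable_on {c..d}"
      by (rule set_integral_add(1)[rotated])
    then show ?thesis
      by (rule absolutely_integrable_spike[OF _ negligible_empty]) (use c in \<open>auto simp: coeff\<close>)
  qed
  obtain u u' :: "real \<Rightarrow> real" where u: "ode_solution (radial_coeff l k \<phi>) u u'"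
    and ulim: "((\<lambda>r. u r / r ^ (l + 1)) \<longlongrightarrow> 1) (at_right 0)"
    using regular_ode_solution_exists[OF Qt, of l] unfolding coeff by blast
  \<comment> \<open>Vanishing Cauchy data at \<open>r\<close> would make \<open>u\<close> zero on
    all of \<open>(0, r]\<close>, against the limit 1 at the origin.\<close>
  have nz: "u r \<noteq> 0 \<or> u' r \<noteq> 0" if r: "r > 0" for r
  proof (rule ccontr)
    assume "\<not> ?thesis"
    then have "u x = 0" if "0 < x" "x \<le> r" for x
      using ode_solution_backward_unique[OF u q _ _ that] by simp
    then have "\<forall>\<^sub>F x in at_right 0. u x / x ^ (l + 1) = 0"
      using r by (intro eventually_at_rightI[of 0 r]) auto
    then have "((\<lambda>x. u x / x ^ (l + 1)) \<longlongrightarrow> 0) (at_right 0)" by (rule tendsto_eventually)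
    then show False using tendsto_unique[OF _ ulim] by fastforce
  qed
  obtain A :: complex where A: "A \<noteq> 0"
    and lim: "((\<lambda>r. u r - Im (A * (cis (k * r) * deviation_factor \<phi> a r k)) / k) \<longlongrightarrow> 0) at_top"
    using real_ode_solution_asymptotics[OF assms(1-6) u nz] by blast
  \<comment> \<open>This factor converts \<open>k * r\<close> into the phase:
    \<open>cis (k * r)\<close> is \<open>e\<close> times the exponential of
    \<open>\<i> * phase l k r\<close>.\<close>
  define e where "e = cis (real l * pi / 2)"
  \<comment> \<open>From \<open>Im (A p) = (A p - cnj A cnj p) / (2 \<i>)\<close>, the coefficient
    of \<open>cnj p\<close> in \<open>N Im (A p) / k\<close> is
    \<open>- N cnj A / (2 \<i> k)\<close>. Setting it equal to \<open>e\<close> determines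
    \<open>N\<close>, and this is where \<open>A \<noteq> 0\<close> is used. The coefficient of
    \<open>p\<close> becomes \<open>- e A / cnj A\<close>; the further factor \<open>e\<close> from
    the phase gives \<open>S\<close>.\<close>
  define N where "N = - 2 * \<i> * complex_of_real k * e / cnj A"
  define S where "S = e\<^sup>2 * A / cnj A"
  define y where "y = (\<lambda>r. N * complex_of_real (u r))"
  have N: "N \<noteq> 0" using A k by (simp add: N_def e_def)
  have y: "ode_solution (radial_coeff l k \<phi>) y (\<lambda>r. N * complex_of_real (u' r))"
    unfolding y_def
    by (rule ode_solution_linear[OF bounded_linear_mult_right ode_solution_linear[OF bounded_linear_of_real u]])
  have "((\<lambda>r. N * complex_of_real (u r / r ^ (l + 1))) \<longlongrightarrow> N * complex_of_real 1) (at_right 0)"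
    by (intro tendsto_intros ulim)
  then have ylim: "((\<lambda>r. y r / complex_of_real (r ^ (l + 1))) \<longlongrightarrow> N) (at_right 0)"
    by (simp add: y_def)
  have "regular_solution l k \<phi> N y"
    using y ylim unfolding regular_solution_def radial_solution_iff by blast
  moreover have "z r = y r" if z: "regular_solution l k \<phi> N z" and r: "r > 0" for z r
  proof -
    obtain z' where z': "ode_solution (radial_coeff l k \<phi>) z z'"
      and zlim: "((\<lambda>r. z r / complex_of_real (r ^ (l + 1))) \<longlongrightarrow> N) (at_right 0)"
      using z unfolding regular_solution_def radial_solution_iff by blast
    have "ode_solution (radial_coeff l k \<phi>) (\<lambda>r. z r + - y r) (\<lambda>r. z' r + - (N * complex_of_real (u' r)))"
      by (rule ode_solution_add[OF z' ode_solution_linear[OF bounded_linear_minus[OF bounded_linear_ident] y]])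
    moreover have "((\<lambda>r. (1 / r ^ (l + 1)) *\<^sub>R (z r + - y r)) \<longlongrightarrow> 0) (at_right 0)"
      using tendsto_diff[OF zlim ylim] by (simp add: scaleR_conv_of_real diff_divide_distrib)
    ultimately have "z r + - y r = 0"
      using regular_ode_solution_unique[OF Qt, of l "\<lambda>r. z r + - y r"] r unfolding coeff by blast
    then show ?thesis by simp
  qed
  moreover have "((\<lambda>r. y r -
      (exp (- (\<i> * complex_of_real (phase l k r))) * inverse (deviation_factor \<phi> a r k)
       - exp (\<i> * complex_of_real (phase l k r)) * deviation_factor \<phi> a r k * S)) \<longlongrightarrow> 0) at_top"
  proof -
    have "((\<lambda>r. N * complex_of_real (u r - Im (A * (cis (k * r) * deviation_factor \<phi> a r k)) / k))
        \<longlongrightarrow> N * complex_of_real 0) at_top"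
      by (intro tendsto_intros lim)
    then have "((\<lambda>r. N * complex_of_real (u r - Im (A * (cis (k * r) * deviation_factor \<phi> a r k)) / k))
        \<longlongrightarrow> 0) at_top" by simp
    moreover have "\<forall>\<^sub>F r in at_top.
        N * complex_of_real (u r - Im (A * (cis (k * r) * deviation_factor \<phi> a r k)) / k) =
        y r - (exp (- (\<i> * complex_of_real (phase l k r))) * inverse (deviation_factor \<phi> a r k)
          - exp (\<i> * complex_of_real (phase l k r)) * deviation_factor \<phi> a r k * S)"
      using eventually_ge_at_top[of a]
    proof eventually_elim
      case (elim r)
      define V where "V = deviation_factor \<phi> a r k"
      define p where "p = cis (k * r) * V"
      have V: "V = cis (integral {a..r} \<phi> / (2 * k))"
        unfolding V_def by (rule deviation_factor_eq[OF assms(1-6) elim])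
      have e1: "exp (\<i> * complex_of_real (phase l k r)) = cis (k * r) * cnj e"
        unfolding cis_conv_exp[symmetric] by (simp add: phase_def e_def cis_cnj cis_mult)
      have e2: "exp (- (\<i> * complex_of_real (phase l k r))) = e * cnj (cis (k * r))"
        unfolding exp_minus e1 by (simp add: e_def cis_cnj cis_mult)
      have "e * cnj e = 1" by (simp add: e_def cis_cnj cis_mult)
      then have S: "cis (k * r) * cnj e * V * S = e * A * p / cnj A"
        by (simp add: S_def p_def power2_eq_square algebra_simps)
      have e3: "e * cnj (cis (k * r)) * inverse V = e * cnj p"
        by (simp add: p_def V cis_cnj)
      have im: "complex_of_real (Im (A * p)) = (A * p - cnj A * cnj p) / (2 * \<i>)"
      proof -
        have "complex_of_real (Im w) = (w - cnj w) / (2 * \<i>)" for w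
          by (simp add: complex_diff_cnj) (simp add: complex_eq_iff)
        from this[of "A * p"] show ?thesis by (simp only: complex_cnj_mult)
      qed
      have "N * complex_of_real (Im (A * p) / k) = e * cnj p - e * A * p / cnj A"
        unfolding of_real_divide im using k A by (simp add: N_def field_simps)
      then show ?case
        unfolding e1 e2 V_def[symmetric] S e3 p_def[symmetric] y_def by (simp add: algebra_simps)
    qed
    ultimately show ?thesis by (rule Lim_transform_eventually)
  qed
  ultimately show ?thesis using N by blast
qed

end
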